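(* Let $w\in S_n$ be a Grassmannian permutation with unique descent at position $k$, and let $\lambda=(w_k-k,w_{k-1}-(k-1),\ldots,w_1-1)$ be its associated partition. Let $P(\lambda)=(P_1,\ldots,P_r)$. Then the (total) degree of the Grothendieck polynomial $\mathfrak G_w$ is \[\deg(\mathfrak G_w)=|\lambda|+\sum_{h=1}^{r-1}|P_{h+1}|\cdot\operatorname{sylv}(\lambda^{(h)}).\]
   Context: Grothendieck polynomials: $S_n$ acts on $\mathbb Z[x_1,\ldots,x_n]$ by permuting variables; $s_i$ is the transposition of $i,i+1$. Define $\partial_i f=(f-s_if)/(x_i-x_{i+1})$ and $\pi_i f=\partial_i((1-x_{i+1})f)$. Set $\mathfrak G_{w_0}=x_1^{n-1}x_2^{n-2}\cdots x_{n-1}$ for $w_0=n\,(n-1)\cdots 1$, and whenever $w(i)>w(i+1)$ set $\mathfrak G_{s_iw}=\pi_i(\mathfrak G_w)$; this determines $\mathfrak G_w$ for all $w\in S_n$. The degree is the largest total degree of a monomial appearing. Permutations are in one-line notation $w=w_1\cdots w_n$; $w$ has a descent at $k$ if $w_k>w_{k+1}$; $w$ is Grassmannian if it has exactly one descent. Partitions: $\lambda=(\lambda_1,\ldots,\lambda_k)$ weakly decreasing nonnegative integers, $|\lambda|=\sum\lambda_i$, identified with Young diagrams. $P(\lambda)=(P_1,\ldots,P_r)$ is the ordered set partition of $\{1,\ldots,k\}$ such that $i,j$ are in the same block iff $\lambda_i=\lambda_j$, and $\lambda_i>\lambda_j$ whenever $i\in P_h$, $j\in P_l$, $h<l$. For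 $1\le h\le r-1$, $\lambda^{(h)}=(\lambda_1-\lambda_i,\ldots,\lambda_{i-1}-\lambda_i)$ with $i=\min P_{h+1}$. For a partition $\nu$, $\operatorname{sylv}(\nu)=\max\{m\ge0:(m,m-1,\ldots,1)\subseteq\nu\}$. *)

theory Defs
  imports Main "HOL-Library.Poly_Mapping" "HOL-Combinatorics.Permutations"
begin

text \<open>Polynomials in Z[x_1,...,x_n]: finitely supported maps from monomials
  (exponent vectors nat =>0 nat, variable x_i has index i) to integer coefficients.
  Multiplication is the usual convolution product of Poly_Mapping.\<close>
type_synonym zpoly = "(nat \<Rightarrow>\<^sub>0 nat) \<Rightarrow>\<^sub>0 int"

definition var :: "nat \<Rightarrow> zpoly" where
  "var i = Poly_Mapping.single (Poly_Mapping.single i 1) 1"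

definition tr :: "nat \<Rightarrow> nat \<Rightarrow> nat" where
  "tr i j = (if j = i then Suc i else if j = Suc i then i else j)"

definition swap_var :: "nat \<Rightarrow> zpoly \<Rightarrow> zpoly" where
  "swap_var i f = Poly_Mapping.map_key (Poly_Mapping.map_key (tr i)) f"

definition divdiff :: "nat \<Rightarrow> zpoly \<Rightarrow> zpoly" where
  "divdiff i f = (THE g. (var i - var (Suc i)) * g = f - swap_var i f)"

definition isobaric :: "nat \<Rightarrow> zpoly \<Rightarrow> zpoly" where
  "isobaric i f = divdiff i ((1 - var (Suc i)) * f)"

text \<open>permutations of {1..n} as functions nat => nat, one-line notation w_j = w j\<close>
definition longest :: "nat \<Rightarrow> nat \<Rightarrow> nat" where
  "longest n j = (if 1 \<le> j \<and> j \<le> n then n + 1 - j else j)"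

definition staircase_mono :: "nat \<Rightarrow> zpoly" where
  "staircase_mono n = (\<Prod>i\<in>{1..n}. var i ^ (n - i))"

inductive groth_rel :: "nat \<Rightarrow> (nat \<Rightarrow> nat) \<Rightarrow> zpoly \<Rightarrow> bool" for n where
  top: "groth_rel n (longest n) (staircase_mono n)"
| step: "groth_rel n w G \<Longrightarrow> 1 \<le> i \<Longrightarrow> i < n \<Longrightarrow> w i > w (Suc i)
          \<Longrightarrow> groth_rel n (w \<circ> tr i) (isobaric i G)"

definition groth :: "nat \<Rightarrow> (nat \<Rightarrow> nat) \<Rightarrow> zpoly" where
  "groth n w = (THE G. groth_rel n w G)"

definition total_degree :: "zpoly \<Rightarrow> nat" where
  "total_degree f = Max ((\<lambda>m. \<Sum>i\<in>Poly_Mapping.keys m. Poly_Mapping.lookup m i) ` Poly_Mapping.keys f)"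

definition descent :: "(nat \<Rightarrow> nat) \<Rightarrow> nat \<Rightarrow> bool" where
  "descent w k \<longleftrightarrow> w k > w (Suc k)"

definition grassmannian_at :: "nat \<Rightarrow> (nat \<Rightarrow> nat) \<Rightarrow> nat \<Rightarrow> bool" where
  "grassmannian_at n w k \<longleftrightarrow> 1 \<le> k \<and> k < n \<and> descent w k \<and>
     (\<forall>j. 1 \<le> j \<and> j < n \<and> descent w j \<longrightarrow> j = k)"

text \<open>partitions as nat lists (weakly decreasing), entry lambda_i = lam ! (i-1)\<close>
definition grass_partition :: "(nat \<Rightarrow> nat) \<Rightarrow> nat \<Rightarrow> nat list" where
  "grass_partition w k = map (\<lambda>i. w (k + 1 - i) - (k + 1 - i)) [1..<k+1]"

definition part_size :: "nat list \<Rightarrow> nat" where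
  "part_size lam = sum_list lam"

definition entry :: "nat list \<Rightarrow> nat \<Rightarrow> nat" where
  "entry lam i = (if 1 \<le> i \<and> i \<le> length lam then lam ! (i - 1) else 0)"

text \<open>P(lambda) = (P_1,...,P_r), as a list (0-indexed: P_h = P ! (h-1))\<close>
definition set_part :: "nat list \<Rightarrow> nat set list" where
  "set_part lam = map (\<lambda>v. {i. 1 \<le> i \<and> i \<le> length lam \<and> entry lam i = v})
                      (rev (sorted_list_of_set (set lam)))"

text \<open>lambda^(h), 1 <= h <= r-1, with i = min P_{h+1}\<close>
definition lam_h :: "nat list \<Rightarrow> nat \<Rightarrow> nat list" where
  "lam_h lam h = (let i = Min (set_part lam ! h)
                  in map (\<lambda>j. entry lam j - entry lam i) [1..<i])"

definition sylv :: "nat list \<Rightarrow> nat" where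
  "sylv nu = Max {m. \<forall>j. 1 \<le> j \<and> j \<le> m \<longrightarrow> m + 1 - j \<le> entry nu j}"

end

theory Submission
  imports Defs
begin

text \<open>
  The operators \<open>\<pi>\<^sub>i\<close> satisfy the braid relations, so \<open>\<GG>\<^sub>w\<close> does not depend on the chain of operators.
  Let \<open>A f = \<Sum>\<^sub>\<sigma> sgn \<sigma> \<cdot> \<sigma> f\<close> over the permutations of the first \<open>k\<close> variables and \<open>\<theta> = \<Prod>\<^sub>j (1 - x\<^sub>j)^(j-1)\<close>;
  then \<open>A (\<theta> \<pi>\<^sub>i f) = A (\<theta> f)\<close> for \<open>i < k\<close>.
  A Grassmannian \<open>w\<close> is reached by such \<open>\<pi>\<^sub>i\<close> from the dominant permutation whose first \<open>k\<close> values are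
  those of \<open>w\<close> in decreasing order, and for a dominant permutation the Grothendieck polynomial is the
  monomial of its Lehmer code. As \<open>\<GG>\<^sub>w\<close> is symmetric in \<open>x\<^sub>1, ..., x\<^sub>k\<close>, this gives
  \<open>A \<theta> \<cdot> \<GG>\<^sub>w = A (\<theta> \<cdot> \<Prod>\<^sub>j x\<^sub>j^(\<lambda>\<^sub>j + k - j))\<close>, the determinant of \<open>x\<^sub>i^(\<lambda>\<^sub>j + k - j) (1 - x\<^sub>i)^(j-1)\<close>.
  Up to sign its coefficients at decreasing exponents are minors of a matrix of binomial
  coefficients. Splitting off the first row and writing \<open>(1+x)^(j-1) = (1+x) (1+x)^(j-2)\<close> expresses
  such a minor as a sum of smaller ones, hence all of them are nonnegative, and the extremal exponents
  with nonzero minor are \<open>\<mu>\<^sub>l + k - l\<close> with \<open>\<mu>\<^sub>l = min\<^bsub>t \<le> l\<^esub> (\<lambda>\<^sub>t + t - 1)\<close>. Finally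
  \<open>\<mu>\<^sub>l = \<lambda>\<^sub>l + sylv \<lambda>\<^bsup>(h)\<^esup>\<close> for \<open>l \<in> P\<^bsub>h+1\<^esub>\<close>.
\<close>

section \<open>Variable permutations and isobaric divided differences\<close>

lemma poly_mapping_induct_single [case_names zero add]:
  assumes "P 0"
    and "\<And>f k v. P f \<Longrightarrow> P (f + Poly_Mapping.single k v)"
  shows "P (f :: 'a \<Rightarrow>\<^sub>0 'b::comm_monoid_add)"
proof (induction f rule: update_induct)
  case const
  then show ?case using assms(1) .
next
  case (update f k v)
  have "Poly_Mapping.update k v f = f + Poly_Mapping.single k v"
    by (rule poly_mapping_eqI)
      (use update in \<open>auto simp: lookup_update lookup_add lookup_single when_def in_keys_iff\<close>)
  then show ?case using assms(2) update by simp
qed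

lemma lookup_map_key: "inj s \<Longrightarrow> Poly_Mapping.lookup (Poly_Mapping.map_key s f) i = Poly_Mapping.lookup f (s i)"
  by (simp add: map_key.rep_eq)

text \<open>The inner pullback acts on exponent vectors, the outer one on coefficient functions.
  Together they are covariant: a bijection \<open>s\<close> sends variable \<open>i\<close> to
  \<open>s i\<close>, a left action extending \<open>swap_var\<close> beyond adjacent
  transpositions.\<close>

definition permute_vars :: "(nat \<Rightarrow> nat) \<Rightarrow> zpoly \<Rightarrow> zpoly" where
  "permute_vars s f = Poly_Mapping.map_key (Poly_Mapping.map_key s) f"

lemma map_key_inv:
  assumes "bij s"
  shows "Poly_Mapping.map_key s (Poly_Mapping.map_key (inv s) m) = m"
    "Poly_Mapping.map_key (inv s) (Poly_Mapping.map_key s m) = m"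
proof -
  have "inj s" "inj (inv s)" using assms bij_imp_bij_inv bij_is_inj by blast+
  then show "Poly_Mapping.map_key s (Poly_Mapping.map_key (inv s) m) = m"
    "Poly_Mapping.map_key (inv s) (Poly_Mapping.map_key s m) = m"
    by (simp_all only: poly_mapping_eq_iff fun_eq_iff lookup_map_key inv_f_f
        surj_f_inv_f[OF bij_is_surj[OF assms]] simp_thms)
qed

lemma inj_map_key: "bij s \<Longrightarrow> inj (Poly_Mapping.map_key s :: ('a \<Rightarrow>\<^sub>0 nat) \<Rightarrow> 'a \<Rightarrow>\<^sub>0 nat)"
  by (rule inj_on_inverseI[where g = "Poly_Mapping.map_key (inv s)"]) (simp add: map_key_inv)

lemma lookup_permute_vars:
  "bij s \<Longrightarrow> Poly_Mapping.lookup (permute_vars s f) m = Poly_Mapping.lookup f (Poly_Mapping.map_key s m)"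
  by (simp add: permute_vars_def lookup_map_key inj_map_key)

lemma permute_vars_single:
  assumes "bij s"
  shows "permute_vars s (Poly_Mapping.single m c) = Poly_Mapping.single (Poly_Mapping.map_key (inv s) m) c"
  by (rule poly_mapping_eqI)
    (use assms in \<open>auto simp: lookup_permute_vars lookup_single when_def map_key_inv\<close>)

lemma permute_vars_zero [simp]: "bij s \<Longrightarrow> permute_vars s 0 = 0"
  by (rule poly_mapping_eqI) (simp add: lookup_permute_vars)

lemma permute_vars_add: "bij s \<Longrightarrow> permute_vars s (f + g) = permute_vars s f + permute_vars s g"
  by (rule poly_mapping_eqI) (simp add: lookup_permute_vars lookup_add)

lemma permute_vars_diff: "bij s \<Longrightarrow> permute_vars s (f - g) = permute_vars s f - permute_vars s g"
  by (rule poly_mapping_eqI) (simp add: lookup_permute_vars lookup_minus)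

text \<open>Both sides are additive in each factor, so two inductions reduce the claim to a product
  of two terms, where it is additivity of the renaming of exponents.\<close>

lemma permute_vars_mult:
  assumes "bij s"
  shows "permute_vars s (f * g) = permute_vars s f * permute_vars s g"
proof -
  have single: "permute_vars s (Poly_Mapping.single m c * g)
      = permute_vars s (Poly_Mapping.single m c) * permute_vars s g" for m c
  proof (induction g rule: poly_mapping_induct_single)
    case (add g k v)
    have "inj (inv s)" using assms bij_imp_bij_inv bij_is_inj by blast
    then show ?case using assms add
      by (simp add: distrib_left permute_vars_add mult_single permute_vars_single map_key_plus)
  qed (use assms in simp)
  show ?thesis
    by (induction f rule: poly_mapping_induct_single)
      (use assms in \<open>auto simp: distrib_right permute_vars_add single\<close>)
qed

lemma permute_vars_const [simp]:
  "bij s \<Longrightarrow> permute_vars s (Poly_Mapping.single 0 c) = Poly_Mapping.single 0 c"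
  by (simp add: bij_imp_bij_inv bij_is_inj map_key_zero permute_vars_single)

lemma permute_vars_one [simp]: "bij s \<Longrightarrow> permute_vars s 1 = 1"
  using permute_vars_const[of s 1] by (simp only: single_one)

lemma permute_vars_power: "bij s \<Longrightarrow> permute_vars s (f ^ n) = permute_vars s f ^ n"
  by (induction n) (simp_all add: permute_vars_mult)

lemma permute_vars_prod: "bij s \<Longrightarrow> permute_vars s (prod f S) = (\<Prod>x\<in>S. permute_vars s (f x))"
  by (induction S rule: infinite_finite_induct) (simp_all add: permute_vars_mult)

lemma permute_vars_var [simp]:
  assumes "bij s" shows "permute_vars s (var i) = var (s i)"
proof -
  have "Poly_Mapping.map_key (inv s) (Poly_Mapping.single i 1) = Poly_Mapping.single (s i) (1::nat)"
    using map_key_single[of "inv s" "s i" "1::nat"] assms bij_imp_bij_inv bij_is_inj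
    by (metis inv_f_f)
  then show ?thesis using assms by (simp add: var_def permute_vars_single)
qed

lemma permute_vars_comp:
  assumes "bij s" "bij t"
  shows "permute_vars s (permute_vars t f) = permute_vars (s \<circ> t) f"
  by (rule poly_mapping_eqI)
    (use assms in \<open>simp add: lookup_permute_vars bij_comp map_key_compose bij_is_inj\<close>)

lemma tr_eq_transpose: "tr i = Transposition.transpose i (Suc i)"
  by (auto simp: tr_def fun_eq_iff Transposition.transpose_def)

lemma bij_tr [simp]: "bij (tr i)"
  by (simp add: tr_eq_transpose)

lemma tr_tr [simp]: "tr i (tr i j) = j"
  by (auto simp: tr_def)

lemma tr_comp_tr [simp]: "tr i \<circ> tr i = id"
  by auto

lemma swap_var_eq: "swap_var i f = permute_vars (tr i) f"
  by (simp add: swap_var_def permute_vars_def)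

lemma swap_var_swap_var [simp]: "swap_var i (swap_var i f) = f"
  by (rule poly_mapping_eqI) (simp add: swap_var_eq permute_vars_comp lookup_permute_vars bij_id,
      simp add: id_def map_key_id)

lemma swap_var_mult: "swap_var i (f * g) = swap_var i f * swap_var i g"
  and swap_var_diff: "swap_var i (f - g) = swap_var i f - swap_var i g"
  and swap_var_add: "swap_var i (f + g) = swap_var i f + swap_var i g"
  and swap_var_one [simp]: "swap_var i 1 = 1"
  and swap_var_var [simp]: "swap_var i (var j) = var (tr i j)"
  by (simp_all add: swap_var_eq permute_vars_mult permute_vars_diff permute_vars_add permute_vars_power)

lemma var_inject [simp]: "var i = var j \<longleftrightarrow> i = j"
proof
  assume "var i = var j"
  then have "Poly_Mapping.keys (var i) = Poly_Mapping.keys (var j)" by simp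
  then have "Poly_Mapping.single i (1::nat) = Poly_Mapping.single j 1" by (simp add: var_def)
  then have "Poly_Mapping.keys (Poly_Mapping.single i (1::nat)) = Poly_Mapping.keys (Poly_Mapping.single j (1::nat))"
    by (rule arg_cong)
  then show "i = j" by simp
qed simp

text \<open>The identity \<open>g h - s (g h) = g (h - s h) + s h (g - s g)\<close> passes
  divisibility on to products, which leaves only variables and constants.\<close>

lemma var_dvd_diff_swap: "var i - var (Suc i) dvd f - swap_var i f"
proof (induction f rule: poly_mapping_induct_single)
  case zero
  then show ?case by (simp add: swap_var_eq)
next
  case (add f m c)
  let ?d = "var i - var (Suc i)"
  have mult: "?d dvd g * h - swap_var i (g * h)" if "?d dvd g - swap_var i g" "?d dvd h - swap_var i h" for g h
  proof -
    have "g * h - swap_var i (g * h) = g * (h - swap_var i h) + swap_var i h * (g - swap_var i g)"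
      by (simp add: swap_var_mult algebra_simps)
    then show ?thesis using that by (metis dvd_add dvd_mult)
  qed
  have var: "?d dvd var j - swap_var i (var j)" for j
    by (auto simp: tr_def) (metis dvd_minus_iff dvd_refl minus_diff_eq)
  have pow: "?d dvd var j ^ e - swap_var i (var j ^ e)" for j e
    by (induction e) (auto intro: mult var)
  have mon: "?d dvd Poly_Mapping.single m c - swap_var i (Poly_Mapping.single m c)" for m c
  proof (induction m rule: poly_mapping_induct_single)
    case zero
    have "swap_var i (Poly_Mapping.single 0 c) = Poly_Mapping.single 0 c"
      by (simp add: swap_var_eq)
    then show ?case by simp
  next
    case (add m j e)
    have "Poly_Mapping.single (Poly_Mapping.single j e) 1 = var j ^ e"
    proof (induction e)
      case (Suc e)
      have "Poly_Mapping.single (Poly_Mapping.single j (Suc e)) 1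
          = var j * Poly_Mapping.single (Poly_Mapping.single j e) 1"
        by (simp add: var_def mult_single flip: single_add)
      then show ?case using Suc by simp
    qed simp
    then have "Poly_Mapping.single (m + Poly_Mapping.single j e) c = Poly_Mapping.single m c * var j ^ e"
      by (metis mult.right_neutral mult_single)
    then show ?case using mult[OF add pow] by simp
  qed
  have "f + Poly_Mapping.single m c - swap_var i (f + Poly_Mapping.single m c)
    = (f - swap_var i f) + (Poly_Mapping.single m c - swap_var i (Poly_Mapping.single m c))"
    by (simp add: swap_var_add)
  then show ?case using add mon by (metis dvd_add)
qed

text \<open>This resolves the definite description in \<open>divdiff\<close>: a quotient exists by
  the preceding divisibility and is unique because there are no zero divisors. Later identities are
  proved with denominators cleared in this way.\<close>

lemma isobaric_mult:
  "(var i - var (Suc i)) * isobaric i f = (1 - var (Suc i)) * f - (1 - var i) * swap_var i f"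
proof -
  let ?h = "(1 - var (Suc i)) * f"
  obtain g where g: "?h - swap_var i ?h = (var i - var (Suc i)) * g"
    using var_dvd_diff_swap by (rule dvdE)
  have "var i - var (Suc i) \<noteq> 0" by simp
  then have "divdiff i ?h = g"
    unfolding divdiff_def by (intro the_equality) (use g in \<open>auto simp del: right_minus_eq\<close>)
  then show ?thesis using g by (simp add: isobaric_def swap_var_mult swap_var_diff tr_def)
qed

lemma isobaric_eqI:
  assumes "(var i - var (Suc i)) * g = (1 - var (Suc i)) * f - (1 - var i) * swap_var i f"
  shows "isobaric i f = g"
proof -
  have "var i - var (Suc i) \<noteq> 0" by simp
  then show ?thesis using assms isobaric_mult[of i f] by (metis mult_left_cancel)
qed

text \<open>Under \<open>swap_var i\<close> the numerator and the denominator of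
  \<open>isobaric i f\<close> both change sign.\<close>

lemma swap_isobaric [simp]: "swap_var i (isobaric i f) = isobaric i f"
proof (rule isobaric_eqI[symmetric])
  have "swap_var i ((var i - var (Suc i)) * isobaric i f) =
     (1 - var i) * swap_var i f - (1 - var (Suc i)) * f"
    unfolding isobaric_mult by (simp add: swap_var_mult swap_var_diff tr_def)
  then show "(var i - var (Suc i)) * swap_var i (isobaric i f)
      = (1 - var (Suc i)) * f - (1 - var i) * swap_var i f"
    by (simp add: swap_var_mult swap_var_diff tr_def algebra_simps)
qed

section \<open>Braid relations and well-definedness\<close>

lemma swap_var_commute:
  assumes "Suc i < j"
  shows "swap_var i (swap_var j f) = swap_var j (swap_var i f)"
proof -
  have "tr i \<circ> tr j = tr j \<circ> tr i" using assms by (auto simp: tr_def fun_eq_iff)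
  then show ?thesis by (simp add: swap_var_eq permute_vars_comp)
qed

lemma swap_var_braid:
  "swap_var i (swap_var (Suc i) (swap_var i f)) = swap_var (Suc i) (swap_var i (swap_var (Suc i) f))"
proof -
  have "tr i \<circ> (tr (Suc i) \<circ> tr i) = tr (Suc i) \<circ> (tr i \<circ> tr (Suc i))"
    by (auto simp: tr_def fun_eq_iff)
  then show ?thesis by (simp add: swap_var_eq permute_vars_comp bij_comp)
qed

text \<open>With both denominators cleared, the right side is invariant under exchanging
  \<open>i\<close> and \<open>j\<close> once the two swaps commute.\<close>

lemma isobaric_isobaric:
  assumes "Suc i < j \<or> Suc j < i"
  shows "(var i - var (Suc i)) * (var j - var (Suc j)) * isobaric i (isobaric j f)
    = (1 - var (Suc i)) * (1 - var (Suc j)) * f - (1 - var (Suc i)) * (1 - var j) * swap_var j f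
      - (1 - var i) * (1 - var (Suc j)) * swap_var i f
      + (1 - var i) * (1 - var j) * swap_var i (swap_var j f)" (is "?D * _ = ?R")
proof -
  define a b c d where abcd: "a = var i" "b = var (Suc i)" "c = var j" "d = var (Suc j)"
  define h where "h = isobaric j f"
  have h: "(c - d) * h = (1 - d) * f - (1 - c) * swap_var j f"
    by (simp add: h_def abcd isobaric_mult)
  have sh: "(c - d) * swap_var i h = (1 - d) * swap_var i f - (1 - c) * swap_var i (swap_var j f)"
    using arg_cong[OF h, of "swap_var i"] assms
    by (simp add: swap_var_mult swap_var_diff abcd tr_def split: if_splits)
  have "(a - b) * (c - d) * isobaric i h = (c - d) * ((a - b) * isobaric i h)" by (simp add: ac_simps)
  also have "\<dots> = (1 - b) * ((c - d) * h) - (1 - a) * ((c - d) * swap_var i h)"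
    unfolding abcd isobaric_mult by (simp add: algebra_simps)
  also have "\<dots> = (1 - b) * (1 - d) * f - (1 - b) * (1 - c) * swap_var j f
      - (1 - a) * (1 - d) * swap_var i f + (1 - a) * (1 - c) * swap_var i (swap_var j f)"
    unfolding h sh by (simp add: algebra_simps)
  finally show ?thesis by (simp add: abcd h_def)
qed

lemma isobaric_commute:
  assumes "Suc i < j"
  shows "isobaric i (isobaric j f) = isobaric j (isobaric i f)"
proof -
  have "(var i - var (Suc i)) * (var j - var (Suc j)) * isobaric i (isobaric j f)
      = (var j - var (Suc j)) * (var i - var (Suc i)) * isobaric j (isobaric i f)"
    using assms
    by (simp only: isobaric_isobaric simp_thms disj_imp)
      (simp add: swap_var_commute[OF assms, of f] algebra_simps)
  then show ?thesis by (simp add: mult.commute[of "var j - var (Suc j)"])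
qed

text \<open>Multiplied by the Vandermonde product of the three variables, either side becomes the
  same signed sum over their six permutations. The proof unfolds one side to this sum and folds it
  up to the other.\<close>

lemma isobaric_braid:
  "isobaric i (isobaric (Suc i) (isobaric i f)) = isobaric (Suc i) (isobaric i (isobaric (Suc i) f))"
proof -
  define a b c where abc: "a = var i" "b = var (Suc i)" "c = var (Suc (Suc i))"
  define s where "s = swap_var i"
  define t where "t = swap_var (Suc i)"
  define P where "P = isobaric i"
  define Q where "Q = isobaric (Suc i)"
  have [simp]: "s a = b" "s b = a" "s c = c" "t a = a" "t b = c" "t c = b"
    by (auto simp: s_def t_def abc tr_def)
  have hom [simp]: "s (x * y) = s x * s y" "s (x - y) = s x - s y" "s 1 = 1"
     "t (x * y) = t x * t y" "t (x - y) = t x - t y" "t 1 = 1" for x y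
    by (auto simp: s_def t_def swap_var_mult swap_var_diff)
  have [simp]: "s (P x) = P x" "t (Q x) = Q x" "s (s x) = x" "t (t x) = x" for x
    by (auto simp: s_def t_def P_def Q_def)
  have sts: "t (s (t x)) = s (t (s x))" for x by (simp add: s_def t_def swap_var_braid)
  have P: "(a - b) * P x = (1 - b) * x - (1 - a) * s x" for x
    by (simp add: P_def abc s_def isobaric_mult)
  have Q: "(b - c) * Q x = (1 - c) * x - (1 - b) * t x" for x
    by (simp add: Q_def abc t_def isobaric_mult)
  have sQ: "(a - c) * s (Q x) = (1 - c) * s x - (1 - a) * s (t x)" for x
    using arg_cong[OF Q[of x], of s] by simp
  have tP: "(a - c) * t (P x) = (1 - c) * t x - (1 - a) * t (s x)" for x
    using arg_cong[OF P[of x], of t] by simp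
  have stP: "(b - c) * s (t (P x)) = (1 - c) * s (t x) - (1 - b) * s (t (s x))" for x
    using arg_cong[OF tP[of x], of s] by simp
  have tsQ: "(a - b) * t (s (Q x)) = (1 - b) * t (s x) - (1 - a) * s (t (s x))" for x
    using arg_cong[OF sQ[of x], of t] by (simp add: sts)
  have "(a - b) * (a - c) * (b - c) * P (Q (P f)) = (a - c) * (b - c) * ((a - b) * P (Q (P f)))"
    by (simp add: ac_simps)
  also have "\<dots> = (1 - b) * (a - c) * ((b - c) * Q (P f)) - (1 - a) * (b - c) * ((a - c) * s (Q (P f)))"
    unfolding P by (simp add: algebra_simps)
  also have "\<dots> = (1 - c) ^ 2 * ((a - b) * P f) - (1 - b) ^ 2 * ((a - c) * t (P f))
      + (1 - a) ^ 2 * ((b - c) * s (t (P f)))"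
    unfolding Q sQ by (simp add: algebra_simps power2_eq_square)
  \<comment> \<open>All six images of \<open>f\<close> occur here, grouped into the numerators of
    \<open>Q f\<close>, \<open>s (Q f)\<close> and \<open>t (s (Q f))\<close>.\<close>
  also have "\<dots> = (1 - b) * (1 - c) * ((1 - c) * f - (1 - b) * t f)
      - (1 - a) * (1 - c) * ((1 - c) * s f - (1 - a) * s (t f))
      + (1 - a) * (1 - b) * ((1 - b) * t (s f) - (1 - a) * s (t (s f)))"
    unfolding P tP stP by (simp add: algebra_simps power2_eq_square)
  also have "\<dots> = (1 - b) * (1 - c) * ((b - c) * Q f) - (1 - a) * (1 - c) * ((a - c) * s (Q f))
      + (1 - a) * (1 - b) * ((a - b) * t (s (Q f)))"
    unfolding Q sQ tsQ ..
  \<comment> \<open>The term in \<open>Q f\<close> is split by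
    \<open>b - c = (a - c) - (a - b)\<close>, and its second half is written as
    \<open>t (Q f)\<close>, which equals \<open>Q f\<close>.\<close>
  also have "\<dots> = (1 - c) * (a - c) * ((1 - b) * Q f - (1 - a) * s (Q f))
      - (1 - b) * (a - b) * ((1 - c) * t (Q f) - (1 - a) * t (s (Q f)))"
    by (simp add: algebra_simps)
  also have "\<dots> = (1 - c) * (a - c) * ((a - b) * P (Q f)) - (1 - b) * (a - b) * ((a - c) * t (P (Q f)))"
    unfolding P tP ..
  also have "\<dots> = (a - b) * (a - c) * ((b - c) * Q (P (Q f)))"
    unfolding Q by (simp add: algebra_simps)
  finally have "(a - b) * (a - c) * (b - c) * P (Q (P f)) = (a - b) * (a - c) * (b - c) * Q (P (Q f))"
    by (simp add: ac_simps)
  then show ?thesis by (simp add: abc P_def Q_def)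
qed

section \<open>Induction on ascents and independence of the chain of operators\<close>

lemma tr_permutes: "1 \<le> i \<Longrightarrow> i < n \<Longrightarrow> tr i permutes {1..n}"
  by (simp add: tr_eq_transpose permutes_swap_id)

text \<open>Exchanging the values at an ascent lowers the sum of \<open>j * w j\<close>. Arbitrary
  functions are allowed because the same induction later sorts exponent vectors.\<close>

lemma ascent_induct [case_names ascents]:
  fixes w :: "nat \<Rightarrow> nat"
  assumes "\<And>w. (\<And>i. 1 \<le> i \<Longrightarrow> i < n \<Longrightarrow> w i < w (Suc i) \<Longrightarrow> P (w \<circ> tr i)) \<Longrightarrow> P w"
  shows "P w"
proof (induction "\<Sum>j\<in>{1..n}. j * w j" arbitrary: w rule: less_induct)
  case less
  show ?case
  proof (rule assms)
    fix i assume i: "1 \<le> i" "i < n" "w i < w (Suc i)"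
    have split: "(\<Sum>j\<in>{1..n}. j * v j)
      = (\<Sum>j\<in>{1..n} - {i, Suc i}. j * v j) + i * v i + Suc i * v (Suc i)" for v :: "nat \<Rightarrow> nat"
    proof -
      have "{i, Suc i} \<subseteq> {1..n}" using i by auto
      then show ?thesis using sum.subset_diff[of "{i, Suc i}" "{1..n}" "\<lambda>j. j * v j"] by simp
    qed
    have "(\<Sum>j\<in>{1..n} - {i, Suc i}. j * (w \<circ> tr i) j) = (\<Sum>j\<in>{1..n} - {i, Suc i}. j * w j)"
      by (rule sum.cong) (auto simp: tr_def)
    then have "(\<Sum>j\<in>{1..n}. j * (w \<circ> tr i) j) < (\<Sum>j\<in>{1..n}. j * w j)"
      using i by (subst (1 2) split) (simp add: tr_def)
    then show "P (w \<circ> tr i)" by (rule less.hyps)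
  qed
qed

lemma perm_ascent_induct [consumes 1, case_names ascents]:
  assumes "w permutes {1..n}"
    and "\<And>w. w permutes {1..n} \<Longrightarrow>
      (\<And>i. 1 \<le> i \<Longrightarrow> i < n \<Longrightarrow> w i < w (Suc i) \<Longrightarrow> P (w \<circ> tr i)) \<Longrightarrow> P w"
  shows "P w"
  using assms(1)
proof (induction w rule: ascent_induct[of n])
  case (ascents w)
  show ?case
    by (rule assms(2)[OF ascents.prems])
      (use ascents.IH ascents.prems permutes_compose[OF tr_permutes] in blast)
qed

text \<open>Strict decrease squeezes \<open>w i + i\<close>: counting from
  \<open>w 1 \<le> n\<close> bounds it above by \<open>n + 1\<close>, counting back from
  \<open>1 \<le> w n\<close> bounds it below.\<close>

lemma permutes_no_ascent_eq_longest:
  assumes w: "w permutes {1..n}" and desc: "\<And>i. 1 \<le> i \<Longrightarrow> i < n \<Longrightarrow> \<not> w i < w (Suc i)"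
  shows "w = longest n"
proof
  fix j
  have desc': "w (Suc i) < w i" if "1 \<le> i" "i < n" for i
    using desc[OF that] permutes_inj[OF w] by (metis inj_eq linorder_neqE_nat n_not_Suc_n)
  have mem: "1 \<le> w i \<and> w i \<le> n" if "1 \<le> i" "i \<le> n" for i
    using permutes_in_image[OF w, of i] that by simp
  have up: "w i + i \<le> n + 1" if "1 \<le> i" "i \<le> n" for i
    using that(1,2)
  proof (induction i rule: dec_induct)
    case base
    then show ?case using mem[of 1] by simp
  next
    case (step i)
    then show ?case using desc'[of i] by simp
  qed
  have low: "n + 1 \<le> w i + i" if "i \<le> n" "1 \<le> i" for i
    using that(1,2)
  proof (induction rule: inc_induct)
    case base
    then show ?case using mem[of n] by simp
  next
    case (step i)
    then show ?case using desc'[of i] by simp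
  qed
  show "w j = longest n j"
  proof (cases "1 \<le> j \<and> j \<le> n")
    case True
    then show ?thesis using up[of j] low[of j] by (simp add: longest_def)
  next
    case False
    then show ?thesis using permutes_not_in[OF w, of j] by (auto simp: longest_def)
  qed
qed

lemma longest_descent: "1 \<le> i \<Longrightarrow> i < n \<Longrightarrow> longest n (Suc i) < longest n i"
  by (simp add: longest_def)

lemma longest_permutes: "longest n permutes {1..n}"
proof (rule bij_imp_permutes)
  show "bij_betw (longest n) {1..n} {1..n}"
    by (rule bij_betwI[where g = "longest n"]) (auto simp: longest_def)
qed (auto simp: longest_def)

lemma groth_rel_ascent:
  assumes "groth_rel n (w \<circ> tr i) G" "1 \<le> i" "i < n" "w i < w (Suc i)"
  shows "groth_rel n w (isobaric i G)"
proof -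
  have "w \<circ> tr i \<circ> tr i = w" by (simp add: comp_assoc)
  then show ?thesis using groth_rel.step[OF assms(1-3)] assms(4) by (simp add: tr_def)
qed

lemma groth_rel_exists:
  assumes "w permutes {1..n}" shows "\<exists>G. groth_rel n w G"
  using assms
proof (induction rule: perm_ascent_induct)
  case (ascents w)
  show ?case
  proof (cases "\<exists>i. 1 \<le> i \<and> i < n \<and> w i < w (Suc i)")
    case True
    then show ?thesis using ascents.IH groth_rel_ascent by blast
  next
    case False
    then show ?thesis using permutes_no_ascent_eq_longest[OF ascents.hyps] groth_rel.top by blast
  qed
qed

text \<open>Diamond argument: above the two ascents lies a common \<open>y\<close>. By the induction
  hypothesis \<open>G\<close> and \<open>G'\<close> are both computed from a polynomial of
  \<open>y\<close>, and the commutation or braid relation compares the results.\<close>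

lemma groth_rel_unique_step:
  assumes w: "w permutes {1..n}"
    and IH: "\<And>k H H'. 1 \<le> k \<Longrightarrow> k < n \<Longrightarrow> w k < w (Suc k) \<Longrightarrow>
      groth_rel n (w \<circ> tr k) H \<Longrightarrow> groth_rel n (w \<circ> tr k) H' \<Longrightarrow> H = H'"
    and i: "1 \<le> i" "w i < w (Suc i)" "groth_rel n (w \<circ> tr i) G"
    and j: "j < n" "w j < w (Suc j)" "groth_rel n (w \<circ> tr j) G'"
    and "i < j"
  shows "isobaric i G = isobaric j G'"
proof (cases "j = Suc i")
  case False
  define y where "y = w \<circ> tr i \<circ> tr j"
  have trs: "tr i \<circ> tr j = tr j \<circ> tr i" using \<open>i < j\<close> False by (auto simp: tr_def fun_eq_iff)
  have "y permutes {1..n}"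
    unfolding y_def using w i j \<open>i < j\<close> by (intro permutes_compose tr_permutes) auto
  then obtain H where H: "groth_rel n y H" using groth_rel_exists by blast
  have "groth_rel n (w \<circ> tr i) (isobaric j H)"
    by (rule groth_rel_ascent) (use H i j \<open>i < j\<close> False in \<open>auto simp: y_def tr_def\<close>)
  moreover have "groth_rel n (w \<circ> tr j) (isobaric i H)"
  proof (rule groth_rel_ascent)
    show "groth_rel n (w \<circ> tr j \<circ> tr i) H"
      using H by (simp add: y_def comp_assoc trs)
  qed (use i j \<open>i < j\<close> False in \<open>auto simp: tr_def\<close>)
  ultimately have "G = isobaric j H" "G' = isobaric i H"
    using IH[of i G] IH[of j G'] i j \<open>i < j\<close> by auto
  then show ?thesis using isobaric_commute[of i j H] \<open>i < j\<close> False by simp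
next
  case True
  \<comment> \<open>The three increasing values at \<open>i\<close>, \<open>i + 1\<close>,
    \<open>i + 2\<close> are reversed; the two chains to \<open>y\<close> are the two reduced words
    of this reversal.\<close>
  define y where "y = w \<circ> tr i \<circ> tr j \<circ> tr i"
  have trs: "tr i \<circ> (tr j \<circ> tr i) = tr j \<circ> (tr i \<circ> tr j)" using True by (auto simp: tr_def fun_eq_iff)
  have "y permutes {1..n}"
    unfolding y_def using w i j \<open>i < j\<close> by (intro permutes_compose tr_permutes) auto
  then obtain H where H: "groth_rel n y H" using groth_rel_exists by blast
  have "groth_rel n (w \<circ> tr i) (isobaric j (isobaric i H))"
    by (intro groth_rel_ascent) (use H i j True in \<open>auto simp: y_def tr_def\<close>)
  moreover have "groth_rel n (w \<circ> tr j) (isobaric i (isobaric j H))"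
  proof (intro groth_rel_ascent)
    show "groth_rel n (w \<circ> tr j \<circ> tr i \<circ> tr j) H"
      using H by (simp add: y_def comp_assoc trs)
  qed (use i j True in \<open>auto simp: tr_def\<close>)
  ultimately have "G = isobaric j (isobaric i H)" "G' = isobaric i (isobaric j H)"
    using IH[of i G] IH[of j G'] i j \<open>i < j\<close> by auto
  then show ?thesis using isobaric_braid[of i H] True by simp
qed

lemma groth_rel_unique:
  assumes "w permutes {1..n}" "groth_rel n w G" "groth_rel n w G'"
  shows "G = G'"
  using assms
proof (induction arbitrary: G G' rule: perm_ascent_induct)
  case (ascents w)
  have cases: "(w = longest n \<and> F = staircase_mono n) \<or>
     (\<exists>i F'. 1 \<le> i \<and> i < n \<and> w i < w (Suc i) \<and> F = isobaric i F' \<and> groth_rel n (w \<circ> tr i) F')"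
    if "groth_rel n w F" for F
    using that
  proof cases
    case (step u F' i)
    have "w \<circ> tr i = u" using step by (simp add: comp_assoc)
    then show ?thesis using step by (auto intro!: exI[of _ i] exI[of _ F'] simp: tr_def)
  qed simp
  have IH: "\<And>k H H'. 1 \<le> k \<Longrightarrow> k < n \<Longrightarrow> w k < w (Suc k) \<Longrightarrow>
      groth_rel n (w \<circ> tr k) H \<Longrightarrow> groth_rel n (w \<circ> tr k) H' \<Longrightarrow> H = H'"
    using ascents.IH by blast
  show ?case
  proof (cases "w = longest n")
    case True
    have "F = staircase_mono n" if "groth_rel n w F" for F
      using cases[OF that] longest_descent True by (metis order_less_asym)
    then show ?thesis using ascents.prems by blast
  next
    case False
    obtain i F where i: "1 \<le> i" "i < n" "w i < w (Suc i)" "G = isobaric i F" "groth_rel n (w \<circ> tr i) F"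
      using cases[OF ascents.prems(1)] False by blast
    obtain j F' where j: "1 \<le> j" "j < n" "w j < w (Suc j)" "G' = isobaric j F'" "groth_rel n (w \<circ> tr j) F'"
      using cases[OF ascents.prems(2)] False by blast
    consider "i = j" | "i < j" | "j < i" by linarith
    then show ?thesis
    proof cases
      case 1
      then show ?thesis using IH i j by blast
    next
      case 2
      show ?thesis unfolding i(4) j(4)
        by (rule groth_rel_unique_step[OF ascents.hyps IH]) (use i j 2 in auto)
    next
      case 3
      show ?thesis unfolding i(4) j(4)
        by (rule groth_rel_unique_step[OF ascents.hyps IH, symmetric]) (use i j 3 in auto)
    qed
  qed
qed

lemma groth_eqI: "w permutes {1..n} \<Longrightarrow> groth_rel n w G \<Longrightarrow> groth n w = G"
  unfolding groth_def using groth_rel_unique by blast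

lemma groth_rel_groth: "w permutes {1..n} \<Longrightarrow> groth_rel n w (groth n w)"
  using groth_rel_exists groth_eqI by metis

lemma groth_ascent:
  assumes "w permutes {1..n}" "1 \<le> i" "i < n" "w i < w (Suc i)"
  shows "groth n w = isobaric i (groth n (w \<circ> tr i))"
  using assms
  by (intro groth_eqI groth_rel_ascent groth_rel_groth permutes_compose tr_permutes) auto

section \<open>Dominant permutations and antisymmetrization\<close>

definition lehmer :: "nat \<Rightarrow> (nat \<Rightarrow> nat) \<Rightarrow> nat \<Rightarrow> nat" where
  "lehmer n w i = card {j. i < j \<and> j \<le> n \<and> w j < w i}"

lemma lehmer_longest:
  assumes "1 \<le> i" "i \<le> n" shows "lehmer n (longest n) i = n - i"
proof -
  have "{j. i < j \<and> j \<le> n \<and> longest n j < longest n i} = {i<..n}"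
    using assms by (auto simp: longest_def)
  then show ?thesis by (simp add: lehmer_def)
qed

lemma lehmer_descent:
  assumes "i < n" "w (Suc i) < w i" shows "Suc (lehmer n w (Suc i)) \<le> lehmer n w i"
proof -
  have "card (insert (Suc i) {j. Suc i < j \<and> j \<le> n \<and> w j < w (Suc i)})
      \<le> card {j. i < j \<and> j \<le> n \<and> w j < w i}"
    using assms by (intro card_mono) (auto intro: finite_subset[of _ "{..n}"])
  then show ?thesis by (simp add: lehmer_def)
qed

lemma lehmer_ascent:
  assumes "w i < w (Suc i)" shows "lehmer n w i \<le> lehmer n w (Suc i)"
  unfolding lehmer_def
proof (rule card_mono)
  show "finite {j. Suc i < j \<and> j \<le> n \<and> w j < w (Suc i)}"
    by (rule finite_subset[of _ "{..n}"]) auto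
  show "{j. i < j \<and> j \<le> n \<and> w j < w i} \<subseteq> {j. Suc i < j \<and> j \<le> n \<and> w j < w (Suc i)}"
    using assms by (auto simp: Suc_lessI) (metis Suc_lessI order_less_asym)
qed

text \<open>Moving the larger of two adjacent values to the left creates one inversion, counted at
  the larger value. For any other position the counted set is only relabelled by
  \<open>tr i\<close>.\<close>

lemma lehmer_comp_tr:
  assumes "i < n" "w i < w (Suc i)"
  shows "lehmer n (w \<circ> tr i) =
    (lehmer n w)(i := Suc (lehmer n w (Suc i)), Suc i := lehmer n w i)"
proof
  fix j
  consider "j = i" | "j = Suc i" | "j \<noteq> i" "j \<noteq> Suc i" by blast
  then show "lehmer n (w \<circ> tr i) j =
    ((lehmer n w)(i := Suc (lehmer n w (Suc i)), Suc i := lehmer n w i)) j"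
  proof cases
    case 1
    have "{j. i < j \<and> j \<le> n \<and> (w \<circ> tr i) j < (w \<circ> tr i) i}
        = insert (Suc i) {j. Suc i < j \<and> j \<le> n \<and> w j < w (Suc i)}"
      using assms by (auto simp: tr_def)
    then show ?thesis using 1 by (simp add: lehmer_def)
  next
    case 2
    have "{j. Suc i < j \<and> j \<le> n \<and> (w \<circ> tr i) j < (w \<circ> tr i) (Suc i)}
        = {j. i < j \<and> j \<le> n \<and> w j < w i}"
      using assms by (auto simp: tr_def)
    then show ?thesis using 2 by (simp add: lehmer_def)
  next
    case 3
    have "{l. j < l \<and> l \<le> n \<and> (w \<circ> tr i) l < (w \<circ> tr i) j}
        = tr i ` {l. j < l \<and> l \<le> n \<and> w l < w j}" (is "?A = _ ` ?B")
    proof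
      show "?A \<subseteq> tr i ` ?B"
      proof
        fix l assume "l \<in> ?A"
        then have "tr i l \<in> ?B" using assms 3
          by (cases "l = i"; cases "l = Suc i") (auto simp: tr_def)
        then show "l \<in> tr i ` ?B" using image_eqI[of l "tr i" "tr i l"] by simp
      qed
      show "tr i ` ?B \<subseteq> ?A"
      proof
        fix x assume "x \<in> tr i ` ?B"
        then obtain l where "x = tr i l" "j < l" "l \<le> n" "w l < w j" by blast
        then show "x \<in> ?A" using assms 3
          by (cases "l = i"; cases "l = Suc i") (auto simp: tr_def)
      qed
    qed
    moreover have "inj_on (tr i) ?B" using bij_tr bij_is_inj inj_on_subset by blast
    ultimately show ?thesis using 3 by (simp add: lehmer_def card_image)
  qed
qed

lemma swap_var_prod_power:
  assumes "1 \<le> i" "i < n" "\<And>j. swap_var i (F j) = F (tr i j)" "\<And>j. e (tr i j) = e j"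
  shows "swap_var i (\<Prod>j\<in>{1..n}. F j ^ e j) = (\<Prod>j\<in>{1..n}. F j ^ e j)"
proof -
  have "swap_var i (\<Prod>j\<in>{1..n}. F j ^ e j) = (\<Prod>j\<in>{1..n}. F (tr i j) ^ e (tr i j))"
    using assms(3,4) by (simp add: swap_var_eq permute_vars_prod permute_vars_power)
  also have "\<dots> = (\<Prod>j\<in>{1..n}. F j ^ e j)"
    using prod.permute[OF tr_permutes[OF assms(1,2)], of "\<lambda>j. F j ^ e j"] by (simp add: comp_def)
  finally show ?thesis .
qed

text \<open>One step up, the monomial gains a single factor \<open>x_i\<close>, and
  \<open>isobaric i (var i * M) = M\<close> when \<open>M\<close> is symmetric in \<open>x_i\<close>
  and \<open>x_(i+1)\<close>.\<close>

lemma groth_dominant: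
  assumes "w permutes {1..n}" "\<And>i. 1 \<le> i \<Longrightarrow> i < n \<Longrightarrow> lehmer n w (Suc i) \<le> lehmer n w i"
  shows "groth n w = (\<Prod>i\<in>{1..n}. var i ^ lehmer n w i)"
  using assms
proof (induction rule: perm_ascent_induct)
  case (ascents w)
  show ?case
  proof (cases "\<exists>i. 1 \<le> i \<and> i < n \<and> w i < w (Suc i)")
    case False
    then have "w = longest n" using permutes_no_ascent_eq_longest[OF ascents.hyps] by blast
    moreover have "(\<Prod>i\<in>{1..n}. var i ^ lehmer n (longest n) i) = staircase_mono n"
      unfolding staircase_mono_def by (rule prod.cong) (auto simp: lehmer_longest)
    ultimately show ?thesis
      using groth_eqI[OF longest_permutes groth_rel.top] by metis
  next
    case True
    \<comment> \<open>The leftmost ascent is taken: before it the code drops strictly, so raising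
      entry \<open>i\<close> by one keeps the code weakly decreasing.\<close>
    define i where "i = (LEAST i. 1 \<le> i \<and> i < n \<and> w i < w (Suc i))"
    have i: "1 \<le> i" "i < n" "w i < w (Suc i)"
      using LeastI_ex[OF True] by (auto simp: i_def)
    have least: "w (Suc j) < w j" if "1 \<le> j" "j < i" for j
    proof -
      have "\<not> w j < w (Suc j)" using that not_less_Least[of j] i(2) by (force simp: i_def)
      moreover have "w j \<noteq> w (Suc j)"
        using permutes_inj[OF ascents.hyps] by (metis inj_eq n_not_Suc_n)
      ultimately show ?thesis by simp
    qed
    let ?c = "lehmer n w"
    \<comment> \<open>At an ascent the code cannot drop, and dominance forbids it to rise.\<close>
    have ci: "?c i = ?c (Suc i)"
      using lehmer_ascent[of w i n] ascents.prems[of i] i by simp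
    have u: "lehmer n (w \<circ> tr i) = ?c(i := Suc (?c i))"
      using lehmer_comp_tr[of i n w] i ci by auto
    have dominant: "lehmer n (w \<circ> tr i) (Suc j) \<le> lehmer n (w \<circ> tr i) j" if j: "1 \<le> j" "j < n" for j
      using ascents.prems[OF j] lehmer_descent[of j n w] least[of j] j by (auto simp: u)
    have IH: "groth n (w \<circ> tr i) = (\<Prod>j\<in>{1..n}. var j ^ (?c(i := Suc (?c i))) j)"
      using ascents.IH[OF i dominant] by (simp only: u)
    define M where "M = (\<Prod>j\<in>{1..n}. var j ^ ?c j)"
    have "(\<Prod>j\<in>{1..n}. var j ^ (?c(i := Suc (?c i))) j)
       = (\<Prod>j\<in>{1..n}. (if j = i then var i else 1) * var j ^ ?c j)"
      by (rule prod.cong) auto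
    also have "\<dots> = var i * M"
      unfolding prod.distrib M_def using i by (simp add: prod.delta)
    finally have "groth n (w \<circ> tr i) = var i * M" using IH by simp
    moreover have "isobaric i (var i * M) = M"
    proof (rule isobaric_eqI)
      have "swap_var i M = M"
        unfolding M_def using i ci by (intro swap_var_prod_power) (auto simp: tr_def)
      then show "(var i - var (Suc i)) * M
          = (1 - var (Suc i)) * (var i * M) - (1 - var i) * swap_var i (var i * M)"
        by (simp add: swap_var_mult tr_def algebra_simps)
    qed
    ultimately show ?thesis using groth_ascent[OF ascents.hyps i] by (simp add: M_def)
  qed
qed

section \<open>Antisymmetrization in the first \<open>k\<close> variables\<close>

definition antisym :: "nat \<Rightarrow> zpoly \<Rightarrow> zpoly" where
  "antisym k f = (\<Sum>s | s permutes {1..k}. of_int (sign s) * permute_vars s f)"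

text \<open>The exponents grow by one per variable, so for \<open>1 \<le> i < k\<close> this is
  \<open>1 - x_(i+1)\<close> times a polynomial symmetric in \<open>x_i\<close> and
  \<open>x_(i+1)\<close>.\<close>

definition theta :: "nat \<Rightarrow> zpoly" where
  "theta k = (\<Prod>j\<in>{1..k}. (1 - var j) ^ (j - 1))"

lemma antisym_diff: "antisym k (f - g) = antisym k f - antisym k g"
  by (simp add: antisym_def permute_vars_diff permutes_bij right_diff_distrib sum_subtractf)

lemma antisym_swap:
  assumes "1 \<le> i" "i < k" shows "antisym k (swap_var i f) = - antisym k f"
proof -
  have "antisym k (swap_var i f)
      = (\<Sum>s | s permutes {1..k}. of_int (- sign (s \<circ> tr i)) * permute_vars (s \<circ> tr i) f)"
    unfolding antisym_def
  proof (rule sum.cong)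
    fix s assume "s \<in> {s. s permutes {1..k}}"
    then have "permutation s" "bij s"
      using permutes_imp_permutation[of "{1..k}"] permutes_bij by auto
    moreover have "permutation (tr i)" "sign (tr i) = - 1"
      by (auto simp: tr_eq_transpose permutation_swap_id sign_swap_id)
    ultimately show "of_int (sign s) * permute_vars s (swap_var i f)
        = of_int (- sign (s \<circ> tr i)) * permute_vars (s \<circ> tr i) f"
      by (simp add: swap_var_eq permute_vars_comp sign_compose)
  qed simp
  also have "\<dots> = (\<Sum>s | s permutes {1..k}. of_int (- sign s) * permute_vars s f)"
    by (rule sum_permutations_compose_right[OF tr_permutes[OF assms], symmetric])
  finally show ?thesis by (simp add: antisym_def sum_negf)
qed

text \<open>Up to the factor 2, antisymmetrization sees only \<open>h - swap_var i h\<close>. For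
  \<open>theta k * isobaric i f\<close> and \<open>theta k * f\<close> these differences agree,
  because \<open>theta k\<close> supplies the factor \<open>1 - x_(i+1)\<close> of the
  numerator.\<close>

lemma antisym_isobaric:
  assumes i: "1 \<le> i" "i < k"
  shows "antisym k (theta k * isobaric i f) = antisym k (theta k * f)"
proof -
  define a b where "a = var i" and "b = var (Suc i)"
  \<comment> \<open>One factor \<open>1 - x_(i+1)\<close> is removed from \<open>theta k\<close>,
    which makes \<open>T\<close> symmetric in the two variables.\<close>
  define T where "T = (\<Prod>j\<in>{1..k}. (1 - var j) ^ (if j = Suc i then i - 1 else j - 1))"
  have ab: "swap_var i a = b" "swap_var i b = a" by (auto simp: a_def b_def tr_def)
  have theta: "theta k = (1 - b) * T"
  proof -
    have "theta k = (\<Prod>j\<in>{1..k}. (if j = Suc i then 1 - b else 1)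
        * (1 - var j) ^ (if j = Suc i then i - 1 else j - 1))"
      unfolding theta_def by (rule prod.cong) (use i in \<open>auto simp: b_def power_eq_if\<close>)
    also have "\<dots> = (1 - b) * T"
      unfolding prod.distrib T_def using i by (simp add: prod.delta)
    finally show ?thesis .
  qed
  have T: "swap_var i T = T"
    unfolding T_def using i by (intro swap_var_prod_power) (auto simp: tr_def swap_var_diff)
  have double: "2 * antisym k h = antisym k (h - swap_var i h)" for h
    using antisym_swap[OF i, of h] by (simp add: antisym_diff)
  let ?X = "theta k * isobaric i f" and ?Y = "theta k * f"
  have "?X - swap_var i ?X = T * ((a - b) * isobaric i f)"
    by (simp add: theta swap_var_mult swap_var_diff T ab algebra_simps)
  also have "\<dots> = ?Y - swap_var i ?Y"
    unfolding a_def b_def isobaric_mult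
    by (simp add: theta swap_var_mult swap_var_diff T algebra_simps tr_def b_def)
  finally have "2 * antisym k ?X = 2 * antisym k ?Y" by (simp only: double)
  then show ?thesis by simp
qed

text \<open>Sorting the first \<open>k\<close> values into decreasing order uses only swaps at
  positions \<open>i < k\<close>, and the operators belonging to them are invisible after
  multiplication by \<open>theta k\<close> and antisymmetrization.\<close>

lemma antisym_groth_comp:
  assumes w: "w permutes {1..n}" "k \<le> n" and mono: "\<And>i j. 1 \<le> i \<Longrightarrow> i < j \<Longrightarrow> j \<le> k \<Longrightarrow> w i < w j"
    and s: "s permutes {1..k}"
  shows "antisym k (theta k * groth n (w \<circ> s)) = antisym k (theta k * groth n (w \<circ> longest k))"
  using s
proof (induction rule: perm_ascent_induct)
  case (ascents s)
  show ?case
  proof (cases "\<exists>i. 1 \<le> i \<and> i < k \<and> s i < s (Suc i)")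
    case False
    then show ?thesis using permutes_no_ascent_eq_longest[OF ascents.hyps] by blast
  next
    case True
    then obtain i where i: "1 \<le> i" "i < k" "s i < s (Suc i)" by blast
    have "1 \<le> s i" "s (Suc i) \<le> k"
      using permutes_in_image[OF ascents.hyps, of i] permutes_in_image[OF ascents.hyps, of "Suc i"] i by auto
    then have "(w \<circ> s) i < (w \<circ> s) (Suc i)" using mono i by simp
    moreover have "w \<circ> s permutes {1..n}"
      using permutes_compose[OF permutes_subset[OF ascents.hyps] w(1)] w(2) by simp
    ultimately have "groth n (w \<circ> s) = isobaric i (groth n (w \<circ> s \<circ> tr i))"
      using groth_ascent i w(2) by simp
    then show ?thesis using ascents.IH[OF i] antisym_isobaric[OF i(1,2)] by (simp only: comp_assoc)
  qed
qed

text \<open>Adjacent transpositions generate the group. Ascent induction gives this in the form that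
  every \<open>s\<close>, the identity included, acts on \<open>G\<close> as
  \<open>longest k\<close> does.\<close>

lemma permute_vars_invariant:
  assumes sym: "\<And>i. 1 \<le> i \<Longrightarrow> i < k \<Longrightarrow> swap_var i G = G" and s: "s permutes {1..k}"
  shows "permute_vars s G = G"
proof -
  have all: "permute_vars s G = permute_vars (longest k) G" if "s permutes {1..k}" for s
    using that
  proof (induction rule: perm_ascent_induct)
    case (ascents s)
    show ?case
    proof (cases "\<exists>i. 1 \<le> i \<and> i < k \<and> s i < s (Suc i)")
      case False
      then show ?thesis using permutes_no_ascent_eq_longest[OF ascents.hyps] by blast
    next
      case True
      then obtain i where i: "1 \<le> i" "i < k" "s i < s (Suc i)" by blast
      have "permute_vars s G = permute_vars s (permute_vars (tr i) G)"
        using sym i by (simp flip: swap_var_eq)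
      then show ?thesis
        using ascents.IH[OF i] permutes_bij[OF ascents.hyps] by (simp add: permute_vars_comp)
    qed
  qed
  have "permute_vars id G = G"
    by (rule poly_mapping_eqI) (simp add: lookup_permute_vars bij_id, simp add: id_def map_key_id)
  then show ?thesis using all[OF s] all[OF permutes_id] by simp
qed

lemma antisym_mult_symmetric:
  assumes "\<And>i. 1 \<le> i \<Longrightarrow> i < k \<Longrightarrow> swap_var i G = G"
  shows "antisym k (f * G) = antisym k f * G"
  unfolding antisym_def sum_distrib_right
  by (rule sum.cong)
    (auto simp: permute_vars_mult permutes_bij permute_vars_invariant[OF assms] mult.assoc)

text \<open>Positions to the left of \<open>j\<close> carry larger values, so all
  \<open>u j - 1\<close> smaller values are counted.\<close>

lemma lehmer_descending_prefix:
  assumes u: "u permutes {1..n}" and j: "1 \<le> j" "j \<le> k" "k \<le> n"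
    and dec: "\<And>i j. 1 \<le> i \<Longrightarrow> i < j \<Longrightarrow> j \<le> k \<Longrightarrow> u j < u i"
  shows "lehmer n u j = u j - 1"
proof -
  have "u ` {l. j < l \<and> l \<le> n \<and> u l < u j} = {1..<u j}" (is "u ` ?A = _")
  proof
    show "u ` ?A \<subseteq> {1..<u j}"
    proof
      fix v assume "v \<in> u ` ?A"
      then obtain l where "v = u l" "j < l" "l \<le> n" "u l < u j" by blast
      then show "v \<in> {1..<u j}" using permutes_in_image[OF u, of l] j by simp
    qed
    show "{1..<u j} \<subseteq> u ` ?A"
    proof
      fix v assume v: "v \<in> {1..<u j}"
      moreover have "u j \<in> {1..n}" using permutes_in_image[OF u, of j] j by simp
      ultimately have "v \<in> u ` {1..n}" using permutes_image[OF u] by auto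
      then obtain l where l: "v = u l" "1 \<le> l" "l \<le> n" by auto
      have "j < l"
      proof (rule ccontr)
        assume "\<not> j < l"
        then show False using dec[of l j] l v j by (cases "l = j") auto
      qed
      then show "v \<in> u ` ?A" using l v by auto
    qed
  qed
  moreover have "inj_on u ?A" using permutes_inj[OF u] inj_on_subset by blast
  ultimately show ?thesis using card_image[of u ?A] by (simp add: lehmer_def)
qed

text \<open>The permutation \<open>u\<close> has code \<open>u j - 1\<close> on its decreasing
  prefix and 0 on the increasing rest, so it is dominant and its polynomial is a monomial. By
  symmetry \<open>groth n w\<close> can be pulled out of the antisymmetrization; a product is
  stated, which avoids division.\<close>

lemma groth_grassmannian_mult:
  assumes w: "w permutes {1..n}" "k \<le> n"
    and mono: "\<And>i j. 1 \<le> i \<Longrightarrow> i < j \<Longrightarrow> j \<le> k \<Longrightarrow> w i < w j"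
    and mono': "\<And>i j. k < i \<Longrightarrow> i < j \<Longrightarrow> j \<le> n \<Longrightarrow> w i < w j"
  shows "antisym k (theta k) * groth n w = antisym k (theta k * (\<Prod>j\<in>{1..k}. var j ^ (w (k + 1 - j) - 1)))"
proof -
  define u where "u = w \<circ> longest k"
  have u: "u permutes {1..n}" unfolding u_def
    using permutes_compose[OF permutes_subset[OF longest_permutes] w(1)] w(2) by simp
  have low: "u j = w (k + 1 - j)" if "1 \<le> j" "j \<le> k" for j
    using that by (simp add: u_def longest_def)
  have high: "u j = w j" if "k < j" for j
    using that by (simp add: u_def longest_def)
  have dec: "u j < u i" if "1 \<le> i" "i < j" "j \<le> k" for i j
    using mono[of "k + 1 - j" "k + 1 - i"] that by (simp add: low)
  have c_low: "lehmer n u j = u j - 1" if "1 \<le> j" "j \<le> k" for j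
    using lehmer_descending_prefix[OF u that w(2)] dec by blast
  have c_high: "lehmer n u j = 0" if "k < j" for j
  proof -
    have "{l. j < l \<and> l \<le> n \<and> u l < u j} = {}"
      using mono'[OF that] high that by force
    then show ?thesis unfolding lehmer_def by simp
  qed
  have "lehmer n u (Suc i) \<le> lehmer n u i" if "1 \<le> i" "i < n" for i
  proof (cases "Suc i \<le> k")
    case True
    then show ?thesis using dec[of i "Suc i"] that by (simp add: c_low)
  qed (simp add: c_high)
  then have "groth n u = (\<Prod>j\<in>{1..n}. var j ^ lehmer n u j)" using groth_dominant[OF u] by blast
  also have "\<dots> = (\<Prod>j\<in>{1..k}. var j ^ lehmer n u j)"
    by (rule prod.mono_neutral_right) (use w(2) c_high in \<open>auto simp: not_le\<close>)
  also have "\<dots> = (\<Prod>j\<in>{1..k}. var j ^ (w (k + 1 - j) - 1))"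
    by (rule prod.cong) (auto simp: c_low low)
  finally have G: "groth n (w \<circ> longest k) = (\<Prod>j\<in>{1..k}. var j ^ (w (k + 1 - j) - 1))"
    by (simp add: u_def)
  have sym: "swap_var i (groth n w) = groth n w" if "1 \<le> i" "i < k" for i
    using groth_ascent[of w n i] mono[of i "Suc i"] w that by simp
  have "antisym k (theta k) * groth n w = antisym k (theta k * groth n w)"
    using antisym_mult_symmetric[OF sym] by simp
  then show ?thesis
    using antisym_groth_comp[OF w mono permutes_id] G by simp
qed

section \<open>Degrees and coefficients\<close>

lemma poly_mapping_eq_sum_single:
  "f = (\<Sum>m\<in>Poly_Mapping.keys f. Poly_Mapping.single m (Poly_Mapping.lookup f m))"
  by (rule poly_mapping_eqI)
    (auto simp: lookup_sum lookup_single when_def in_keys_iff sum.delta')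

lemma lookup_mult_eq_sum:
  fixes f g :: "'a::monoid_add \<Rightarrow>\<^sub>0 'b::semiring_0"
  shows "Poly_Mapping.lookup (f * g) m = (\<Sum>k\<in>Poly_Mapping.keys f. \<Sum>l\<in>Poly_Mapping.keys g.
    if k + l = m then Poly_Mapping.lookup f k * Poly_Mapping.lookup g l else 0)"
proof -
  have "f * g = (\<Sum>k\<in>Poly_Mapping.keys f. \<Sum>l\<in>Poly_Mapping.keys g.
      Poly_Mapping.single (k + l) (Poly_Mapping.lookup f k * Poly_Mapping.lookup g l))"
    by (subst (1) poly_mapping_eq_sum_single[of f], subst (1) poly_mapping_eq_sum_single[of g])
      (simp add: sum_product mult_single)
  then show ?thesis by (simp add: lookup_sum lookup_single when_def)
qed

section \<open>Total degree and top homogeneous parts\<close>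

definition mono_degree :: "(nat \<Rightarrow>\<^sub>0 nat) \<Rightarrow> nat" where
  "mono_degree m = (\<Sum>i\<in>Poly_Mapping.keys m. Poly_Mapping.lookup m i)"

lemma mono_degree_add: "mono_degree (m + m') = mono_degree m + mono_degree m'"
  unfolding mono_degree_def by (rule setsum_keys_plus_distrib) auto

lemma mono_degree_eq_sum:
  "finite S \<Longrightarrow> Poly_Mapping.keys m \<subseteq> S \<Longrightarrow> mono_degree m = (\<Sum>i\<in>S. Poly_Mapping.lookup m i)"
  unfolding mono_degree_def by (rule sum.mono_neutral_left) (auto simp: in_keys_iff)

lemma total_degree_altdef: "total_degree f = Max (mono_degree ` Poly_Mapping.keys f)"
  by (simp add: total_degree_def mono_degree_def)

lemma mono_degree_le_total_degree: "m \<in> Poly_Mapping.keys f \<Longrightarrow> mono_degree m \<le> total_degree f"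
  unfolding total_degree_altdef by (rule Max_ge) auto

lemma total_degree_eqI:
  assumes "m \<in> Poly_Mapping.keys f" "mono_degree m = d"
    "\<And>m. m \<in> Poly_Mapping.keys f \<Longrightarrow> mono_degree m \<le> d"
  shows "total_degree f = d"
  unfolding total_degree_altdef by (rule Max_eqI) (use assms in auto)

lemma total_degree_attained:
  assumes "f \<noteq> 0" shows "\<exists>m\<in>Poly_Mapping.keys f. mono_degree m = total_degree f"
proof -
  have "total_degree f \<in> mono_degree ` Poly_Mapping.keys f"
    unfolding total_degree_altdef by (rule Max_in) (use assms in auto)
  then show ?thesis by auto
qed

definition top_part :: "zpoly \<Rightarrow> zpoly" where
  "top_part f = (\<Sum>m | m \<in> Poly_Mapping.keys f \<and> mono_degree m = total_degree f.
     Poly_Mapping.single m (Poly_Mapping.lookup f m))"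

lemma lookup_top_part:
  "Poly_Mapping.lookup (top_part f) m = (if mono_degree m = total_degree f then Poly_Mapping.lookup f m else 0)"
  by (auto simp: top_part_def lookup_sum lookup_single when_def in_keys_iff sum.delta')

lemma keys_top_part: "m \<in> Poly_Mapping.keys (top_part f) \<Longrightarrow> mono_degree m = total_degree f"
  by (auto simp: in_keys_iff lookup_top_part split: if_splits)

lemma keys_diff_top_part: "m \<in> Poly_Mapping.keys (f - top_part f) \<Longrightarrow> mono_degree m < total_degree f"
  using mono_degree_le_total_degree[of m f]
  by (auto simp: in_keys_iff lookup_minus lookup_top_part split: if_splits)

lemma top_part_nonzero:
  assumes "f \<noteq> 0" shows "top_part f \<noteq> 0"
proof
  assume "top_part f = 0"
  then show False using total_degree_attained[OF assms] lookup_top_part[of f]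
    by (metis in_keys_iff lookup_zero)
qed

text \<open>The product of the top homogeneous parts is nonzero, there being no zero divisors, and
  all other contributions have smaller degree. The degree of 0 is an unspecified
  \<open>Max {}\<close>, hence the assumptions.\<close>

lemma total_degree_mult:
  fixes f g :: zpoly
  assumes "f \<noteq> 0" "g \<noteq> 0"
  shows "total_degree (f * g) = total_degree f + total_degree g"
proof -
  let ?F = "top_part f" and ?G = "top_part g"
  have "?F * ?G \<noteq> 0" using top_part_nonzero assms by simp
  then obtain m where m: "m \<in> Poly_Mapping.keys (?F * ?G)" by fastforce
  then have md: "mono_degree m = total_degree f + total_degree g"
    using keys_mult[of ?F ?G] by (auto simp: mono_degree_add dest!: keys_top_part)
  have "m \<notin> Poly_Mapping.keys (?F * (g - ?G))"
    using keys_mult[of ?F "g - ?G"] md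
    by (auto simp: mono_degree_add dest!: keys_top_part keys_diff_top_part)
  moreover have "m \<notin> Poly_Mapping.keys ((f - ?F) * g)"
  proof
    assume "m \<in> Poly_Mapping.keys ((f - ?F) * g)"
    then obtain k l where "m = k + l" "k \<in> Poly_Mapping.keys (f - ?F)" "l \<in> Poly_Mapping.keys g"
      using keys_mult[of "f - ?F" g] by blast
    then show False
      using md keys_diff_top_part[of k f] mono_degree_le_total_degree[of l g]
      by (simp add: mono_degree_add)
  qed
  moreover have "f * g = ?F * ?G + ?F * (g - ?G) + (f - ?F) * g" by (simp add: algebra_simps)
  ultimately have "m \<in> Poly_Mapping.keys (f * g)" using m by (simp add: in_keys_iff lookup_add)
  then show ?thesis
  proof (rule total_degree_eqI[OF _ md])
    fix m assume "m \<in> Poly_Mapping.keys (f * g)"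
    then obtain k l where "m = k + l" "k \<in> Poly_Mapping.keys f" "l \<in> Poly_Mapping.keys g"
      using keys_mult[of f g] by blast
    then show "mono_degree m \<le> total_degree f + total_degree g"
      using mono_degree_le_total_degree[of k f] mono_degree_le_total_degree[of l g]
      by (simp add: mono_degree_add)
  qed
qed

section \<open>Coefficients of the antisymmetrized products as minors\<close>

lemma lookup_mult_separated:
  fixes F G :: zpoly
  assumes F: "\<And>m. m \<in> Poly_Mapping.keys F \<Longrightarrow> Poly_Mapping.keys m \<subseteq> {x}"
    and G: "\<And>m. m \<in> Poly_Mapping.keys G \<Longrightarrow> Poly_Mapping.lookup m x = 0"
  shows "Poly_Mapping.lookup (F * G) m = Poly_Mapping.lookup F (Poly_Mapping.single x (Poly_Mapping.lookup m x))
    * Poly_Mapping.lookup G (Poly_Mapping.update x 0 m)"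
proof -
  let ?k = "Poly_Mapping.single x (Poly_Mapping.lookup m x)" and ?l = "Poly_Mapping.update x 0 m"
  have iff: "k + l = m \<longleftrightarrow> k = ?k \<and> l = ?l" if "k \<in> Poly_Mapping.keys F" "l \<in> Poly_Mapping.keys G" for k l
  proof
    assume m: "k + l = m"
    have k: "Poly_Mapping.lookup k i = 0" if "i \<noteq> x" for i
      using F[OF \<open>k \<in> _\<close>] that by (auto simp: in_keys_iff)
    have "k = ?k"
      by (rule poly_mapping_eqI) (use k G[OF \<open>l \<in> _\<close>] m in \<open>auto simp: lookup_single lookup_add when_def\<close>)
    moreover have "l = ?l"
      by (rule poly_mapping_eqI) (use k G[OF \<open>l \<in> _\<close>] m in \<open>auto simp: lookup_update lookup_add\<close>)
    ultimately show "k = ?k \<and> l = ?l" ..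
  next
    assume "k = ?k \<and> l = ?l"
    then show "k + l = m"
      by (auto intro!: poly_mapping_eqI simp: lookup_add lookup_single lookup_update when_def)
  qed
  have "Poly_Mapping.lookup (F * G) m = (\<Sum>k\<in>Poly_Mapping.keys F. \<Sum>l\<in>Poly_Mapping.keys G.
      (if k = ?k then Poly_Mapping.lookup F k else 0) * (if l = ?l then Poly_Mapping.lookup G l else 0))"
    unfolding lookup_mult_eq_sum by (intro sum.cong refl) (auto simp: iff)
  also have "\<dots> = Poly_Mapping.lookup F ?k * Poly_Mapping.lookup G ?l"
    unfolding sum_product[symmetric] by (simp add: sum.delta' in_keys_iff)
  finally show ?thesis .
qed

text \<open>Variables are peeled off one at a time. Injectivity of \<open>v\<close> keeps the
  variable of the new factor out of the others, so a monomial splits between them in only one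
  way.\<close>

lemma lookup_prod_separated:
  fixes F :: "'a \<Rightarrow> zpoly"
  assumes "finite S" "inj_on v S"
    and F: "\<And>j m. j \<in> S \<Longrightarrow> m \<in> Poly_Mapping.keys (F j) \<Longrightarrow> Poly_Mapping.keys m \<subseteq> {v j}"
  shows "Poly_Mapping.lookup (\<Prod>j\<in>S. F j) m = (if Poly_Mapping.keys m \<subseteq> v ` S
    then \<Prod>j\<in>S. Poly_Mapping.lookup (F j) (Poly_Mapping.single (v j) (Poly_Mapping.lookup m (v j))) else 0)"
  using assms
proof (induction S arbitrary: m rule: finite_induct)
  case empty
  then show ?case by (simp add: lookup_one when_def)
next
  case (insert x S)
  let ?G = "\<Prod>j\<in>S. F j" and ?u = "Poly_Mapping.update (v x) 0 m"
  have IH: "Poly_Mapping.lookup ?G m = (if Poly_Mapping.keys m \<subseteq> v ` S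
    then \<Prod>j\<in>S. Poly_Mapping.lookup (F j) (Poly_Mapping.single (v j) (Poly_Mapping.lookup m (v j))) else 0)" for m
    using insert by auto
  have notin: "v x \<notin> v ` S" using insert by auto
  have "Poly_Mapping.lookup (F x * ?G) m
      = Poly_Mapping.lookup (F x) (Poly_Mapping.single (v x) (Poly_Mapping.lookup m (v x)))
        * Poly_Mapping.lookup ?G ?u"
  proof (rule lookup_mult_separated)
    show "Poly_Mapping.lookup l (v x) = 0" if "l \<in> Poly_Mapping.keys ?G" for l
      using that notin IH[of l] by (auto simp: in_keys_iff split: if_splits)
  qed (use insert.prems in auto)
  moreover have "Poly_Mapping.keys ?u \<subseteq> v ` S \<longleftrightarrow> Poly_Mapping.keys m \<subseteq> v ` insert x S"
    using notin by (auto simp: keys_update)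
  moreover have "(\<Prod>j\<in>S. Poly_Mapping.lookup (F j) (Poly_Mapping.single (v j) (Poly_Mapping.lookup ?u (v j))))
    = (\<Prod>j\<in>S. Poly_Mapping.lookup (F j) (Poly_Mapping.single (v j) (Poly_Mapping.lookup m (v j))))"
    using notin by (intro prod.cong) (auto simp: lookup_update)
  ultimately show ?case using insert.hyps IH[of ?u] by simp
qed

text \<open>An integer lower index, with value 0 below zero, makes Pascal's rule unconditional and
  admits any difference of exponents.\<close>

definition ibinom :: "nat \<Rightarrow> int \<Rightarrow> int" where
  "ibinom n d = (if d < 0 then 0 else int (n choose nat d))"

lemma ibinom_0: "ibinom 0 d = (if d = 0 then 1 else 0)"
  by (auto simp: ibinom_def binomial_eq_0)

lemma ibinom_Suc: "ibinom (Suc n) d = ibinom n (d - 1) + ibinom n d"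
proof (cases "d \<le> 0")
  case False
  then obtain e where "d = int (Suc e)" by (metis not_le zero_less_imp_eq_int gr0_implies_Suc)
  then show ?thesis by (simp add: ibinom_def nat_add_distrib del: of_nat_Suc) (simp add: ibinom_def)
qed (auto simp: ibinom_def)

lemma ibinom_nonzero: "ibinom n d \<noteq> 0 \<Longrightarrow> 0 \<le> d \<and> d \<le> int n"
  by (auto simp: ibinom_def split: if_splits)

lemma var_power: "var v ^ e = Poly_Mapping.single (Poly_Mapping.single v e) 1"
proof (induction e)
  case (Suc e)
  then show ?case by (simp add: var_def mult_single flip: single_add)
qed simp

lemma single_zero_int: "Poly_Mapping.single 0 (c :: int) = of_int c"
  by (metis of_int_eq_id id_apply single_of_int)

lemma var_power_mult_one_minus:
  "var v ^ a * (1 - var v) ^ b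
    = (\<Sum>i\<le>b. Poly_Mapping.single (Poly_Mapping.single v (a + i)) ((- 1) ^ i * int (b choose i)))"
proof -
  have "(1 - var v) ^ b = (- var v + 1) ^ b" by simp
  also have "\<dots> = (\<Sum>i\<le>b. of_nat (b choose i) * (- var v) ^ i * 1 ^ (b - i))"
    by (rule binomial_ring)
  finally have "var v ^ a * (1 - var v) ^ b = (\<Sum>i\<le>b. of_int ((- 1) ^ i * int (b choose i)) * var v ^ (a + i))"
    by (simp add: sum_distrib_left power_add power_minus[of "var v"] ac_simps)
  also have "\<dots> = (\<Sum>i\<le>b. Poly_Mapping.single 0 ((- 1) ^ i * int (b choose i)) * var v ^ (a + i))"
    by (simp only: single_zero_int)
  finally show ?thesis by (simp add: var_power mult_single)
qed

lemma keys_var_power_mult_one_minus: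
  "m \<in> Poly_Mapping.keys (var v ^ a * (1 - var v) ^ b) \<Longrightarrow> Poly_Mapping.keys m \<subseteq> {v}"
  unfolding var_power_mult_one_minus using keys_sum by (fastforce split: if_splits)

text \<open>The sign is written with \<open>d + a\<close>, of the same parity as
  \<open>d - a\<close>: this avoids truncated subtraction, and over a product of variables the sign
  depends only on the sum of the exponents.\<close>

lemma lookup_var_power_mult_one_minus:
  "Poly_Mapping.lookup (var v ^ a * (1 - var v) ^ b) (Poly_Mapping.single v d)
    = (- 1) ^ (d + a) * ibinom b (int d - int a)"
proof -
  have eq: "Poly_Mapping.single v x = Poly_Mapping.single v y \<longleftrightarrow> x = y" for x y :: nat
    by (metis lookup_single_eq)
  show ?thesis
  proof (cases "a \<le> d")
    case True
    then obtain e where d: "d = a + e" using le_Suc_ex by blast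
    have "(- 1 :: int) ^ (d + a) = (- 1) ^ e" by (simp add: d power_add mult.assoc flip: power_mult_distrib)
    then show ?thesis
      unfolding var_power_mult_one_minus
      by (cases "e \<le> b") (auto simp: lookup_sum lookup_single when_def eq d ibinom_def sum.delta' binomial_eq_0)
  next
    case False
    then have "a + i \<noteq> d" for i by simp
    then show ?thesis using False
      unfolding var_power_mult_one_minus
      by (simp add: lookup_sum lookup_single when_def eq ibinom_def)
  qed
qed

text \<open>Leibniz expansion with rows \<open>j\<close> and columns \<open>l\<close>: the
  coefficient of the monomial with exponents \<open>m\<close> in the determinant of
  \<open>x_l ^ a j * (1 + x_l) ^ (j - i)\<close>. Raising \<open>i\<close> drops the first row and
  column and lowers every power of \<open>1 + x_l\<close>, as the recursion requires.\<close>

definition minor :: "(nat \<Rightarrow> int) \<Rightarrow> nat \<Rightarrow> nat \<Rightarrow> (nat \<Rightarrow> int) \<Rightarrow> int" where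
  "minor a k i m = (\<Sum>s | s permutes {i..k}. sign s * (\<Prod>l\<in>{i..k}. ibinom (s l - i) (m l - a (s l))))"

text \<open>Each permuted summand is a product of polynomials in distinct single variables, whose
  coefficients are binomial up to sign.\<close>

lemma lookup_antisym_theta_mult:
  "Poly_Mapping.lookup (antisym k (theta k * (\<Prod>j\<in>{1..k}. var j ^ a j))) m
    = (if Poly_Mapping.keys m \<subseteq> {1..k}
       then (- 1) ^ (\<Sum>l\<in>{1..k}. Poly_Mapping.lookup m l + a l)
         * minor (\<lambda>j. int (a j)) k 1 (\<lambda>l. int (Poly_Mapping.lookup m l)) else 0)"
proof -
  let ?S = "{1..k}" and ?h = "theta k * (\<Prod>j\<in>{1..k}. var j ^ a j)"
  let ?e = "(- 1 :: int) ^ (\<Sum>l\<in>{1..k}. Poly_Mapping.lookup m l + a l)"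
  let ?B = "\<lambda>j l. ibinom (j - 1) (int (Poly_Mapping.lookup m l) - int (a j))"
  have scale: "Poly_Mapping.lookup (of_int (sign s) * f) m = sign s * Poly_Mapping.lookup f m"
    for s :: "nat \<Rightarrow> nat" and f :: zpoly
    by (cases s rule: sign_cases) auto
  have summand: "Poly_Mapping.lookup (permute_vars s ?h) m
      = (if Poly_Mapping.keys m \<subseteq> ?S then ?e * (\<Prod>j\<in>?S. ?B j (s j)) else 0)"
    if s: "s permutes ?S" for s
  proof -
    have "permute_vars s ?h = (\<Prod>j\<in>?S. var (s j) ^ a j * (1 - var (s j)) ^ (j - 1))"
      using permutes_bij[OF s]
      by (simp add: theta_def permute_vars_mult permute_vars_prod permute_vars_power permute_vars_diff
          prod.distrib mult.commute)
    also have "Poly_Mapping.lookup \<dots> m = (if Poly_Mapping.keys m \<subseteq> s ` ?S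
       then \<Prod>j\<in>?S. (- 1) ^ (Poly_Mapping.lookup m (s j) + a j) * ?B j (s j) else 0)"
      using s by (subst lookup_prod_separated[where v = s])
        (auto simp: lookup_var_power_mult_one_minus permutes_inj_on dest: keys_var_power_mult_one_minus)
    \<comment> \<open>A permutation preserves the sum of the exponents, so all summands share one
      sign.\<close>
    also have "(\<Prod>j\<in>?S. (- 1 :: int) ^ (Poly_Mapping.lookup m (s j) + a j)) = ?e"
      using sum.permute[OF s, of "Poly_Mapping.lookup m"]
      by (simp add: sum.distrib comp_def flip: power_sum)
    then have "(\<Prod>j\<in>?S. (- 1) ^ (Poly_Mapping.lookup m (s j) + a j) * ?B j (s j))
       = ?e * (\<Prod>j\<in>?S. ?B j (s j))"
      by (simp add: prod.distrib)
    finally show ?thesis by (simp only: permutes_image[OF s])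
  qed
  have "Poly_Mapping.lookup (antisym k ?h) m
      = (\<Sum>s | s permutes ?S. sign s * Poly_Mapping.lookup (permute_vars s ?h) m)"
    by (simp add: antisym_def lookup_sum scale)
  also have "\<dots> = (\<Sum>s | s permutes ?S. sign s *
      (if Poly_Mapping.keys m \<subseteq> ?S then ?e * (\<Prod>j\<in>?S. ?B j (s j)) else 0))"
    by (rule sum.cong) (simp_all only: mem_Collect_eq summand)
  also have "\<dots> = (if Poly_Mapping.keys m \<subseteq> ?S
      then ?e * (\<Sum>s | s permutes ?S. sign s * (\<Prod>j\<in>?S. ?B j (s j))) else 0)"
    by (simp add: sum_distrib_left ac_simps)
  \<comment> \<open>So far row \<open>j\<close> is paired with variable \<open>s j\<close>; passing
    to inverses indexes by columns, as in \<open>minor\<close>.\<close>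
  also have "(\<Sum>s | s permutes ?S. sign s * (\<Prod>j\<in>?S. ?B j (s j)))
      = (\<Sum>s | s permutes ?S. sign (inv s) * (\<Prod>j\<in>?S. ?B j (inv s j)))"
    by (rule sum_permutations_inverse)
  also have "\<dots> = minor (\<lambda>j. int (a j)) k 1 (\<lambda>l. int (Poly_Mapping.lookup m l))"
    unfolding minor_def
  proof (rule sum.cong)
    fix s assume "s \<in> {s. s permutes ?S}"
    then have s: "s permutes ?S" by simp
    have "(\<Prod>j\<in>?S. ?B j (inv s j)) = (\<Prod>l\<in>?S. ?B (s l) l)"
      using prod.permute[OF s, of "\<lambda>j. ?B j (inv s j)"] by (simp add: comp_def permutes_inverses[OF s])
    moreover have "sign (inv s) = sign s"
      by (rule sign_inverse) (use s permutes_imp_permutation[of ?S] in auto)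
    ultimately show "sign (inv s) * (\<Prod>j\<in>?S. ?B j (inv s j)) = sign s * (\<Prod>l\<in>?S. ?B (s l) l)" by simp
  qed simp
  finally show ?thesis .
qed

section \<open>Minors of binomial coefficients\<close>

lemma minor_cong: "(\<And>l. i \<le> l \<Longrightarrow> l \<le> k \<Longrightarrow> m l = m' l) \<Longrightarrow> minor a k i m = minor a k i m'"
  unfolding minor_def by (auto intro!: sum.cong prod.cong)

lemma minor_permute:
  assumes t: "t permutes {i..k}" shows "minor a k i (m \<circ> t) = sign t * minor a k i m"
proof -
  let ?S = "{i..k}"
  have "minor a k i (m \<circ> t) = (\<Sum>s | s permutes ?S. sign (s \<circ> t) *
      (\<Prod>l\<in>?S. ibinom ((s \<circ> t) l - i) ((m \<circ> t) l - a ((s \<circ> t) l))))"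
    unfolding minor_def by (rule sum_permutations_compose_right[OF t])
  also have "\<dots> = (\<Sum>s | s permutes ?S. sign t * (sign s *
      (\<Prod>l\<in>?S. ibinom (s l - i) (m l - a (s l)))))"
  proof (rule sum.cong)
    fix s assume "s \<in> {s. s permutes ?S}"
    then have "sign (s \<circ> t) = sign s * sign t"
      using t permutes_imp_permutation[of ?S] by (auto intro: sign_compose)
    moreover have "(\<Prod>l\<in>?S. ibinom ((s \<circ> t) l - i) ((m \<circ> t) l - a ((s \<circ> t) l)))
        = (\<Prod>l\<in>?S. ibinom (s l - i) (m l - a (s l)))"
      using prod.permute[OF t, of "\<lambda>l. ibinom (s l - i) (m l - a (s l))"] by (simp add: comp_def)
    ultimately show "sign (s \<circ> t) * (\<Prod>l\<in>?S. ibinom ((s \<circ> t) l - i) ((m \<circ> t) l - a ((s \<circ> t) l)))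
       = sign t * (sign s * (\<Prod>l\<in>?S. ibinom (s l - i) (m l - a (s l))))" by simp
  qed simp
  finally show ?thesis by (simp add: minor_def sum_distrib_left)
qed

lemma minor_repeated:
  assumes "l \<in> {i..k}" "l' \<in> {i..k}" "l \<noteq> l'" "m l = m l'"
  shows "minor a k i m = 0"
proof -
  have "m \<circ> Transposition.transpose l l' = m"
    using assms(4) by (auto simp: fun_eq_iff Transposition.transpose_def)
  then have "minor a k i m = - minor a k i m"
    using minor_permute[OF permutes_swap_id[OF assms(1,2)], of a m] assms(3)
    by (simp add: sign_swap_id)
  then show ?thesis by simp
qed

lemma strict_antimono_gap:
  fixes a :: "nat \<Rightarrow> int"
  assumes "\<And>j. i \<le> j \<Longrightarrow> j < k \<Longrightarrow> a (Suc j) < a j" "i \<le> l" "l \<le> l'" "l' \<le> k"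
  shows "a l' + int (l' - l) \<le> a l"
  using assms(3,4)
proof (induction l' rule: dec_induct)
  case (step j)
  then show ?case using assms(1)[of j] assms(2) by (simp add: Suc_diff_le)
qed simp

text \<open>A strict drop of integers is at least 1, so it stays a weak drop when 0 or 1 is
  subtracted from each entry. Equal neighbours may arise; they make the minor vanish.\<close>

lemma antimono_diff:
  fixes m :: "nat \<Rightarrow> int"
  assumes "\<And>l. i \<le> l \<Longrightarrow> l < k \<Longrightarrow> m (Suc l) < m l" "i \<le> l" "l < k"
  shows "m (Suc l) - of_bool (Suc l \<in> X) \<le> m l - of_bool (l \<in> X)"
  using assms(1)[OF assms(2,3)] by (auto simp: of_bool_def)

text \<open>The only exponent that the row of \<open>x ^ a i\<close> can meet is \<open>a i\<close>, which is also the largest exponent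
  of all rows; the other rows are \<open>1 + x\<close> times the rows of the smaller minor.\<close>
lemma minor_rec:
  assumes a: "\<And>j. i \<le> j \<Longrightarrow> j < k \<Longrightarrow> a (Suc j) < a j"
    and m: "\<And>l. i \<le> l \<Longrightarrow> l < k \<Longrightarrow> m (Suc l) < m l"
    and "i \<le> k"
  shows "minor a k i m = (if m i = a i
    then \<Sum>X\<in>Pow {Suc i..k}. minor a k (Suc i) (\<lambda>l. m l - of_bool (l \<in> X)) else 0)"
proof -
  let ?S = "{i..k}" and ?T = "{Suc i..k}"
  let ?t = "\<lambda>s. \<Prod>l\<in>?S. ibinom (s l - i) (m l - a (s l))"
  \<comment> \<open>Some column \<open>l\<close> meets row \<open>i\<close>, so
    \<open>m l = a i\<close>. Exponents in row \<open>j\<close> are at most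
    \<open>a j + (j - i) \<le> a i\<close>, so \<open>m i \<le> m l\<close>, and strict decrease
    forces \<open>l = i\<close>.\<close>
  have fixed: "m i = a i \<and> s i = i" if s: "s permutes ?S" and nz: "?t s \<noteq> 0" for s
  proof -
    have nz: "ibinom (s l - i) (m l - a (s l)) \<noteq> 0" if "l \<in> ?S" for l
      using nz that by (simp add: prod_zero_iff)
    have "i \<in> s ` ?S" using permutes_image[OF s] \<open>i \<le> k\<close> by simp
    then obtain l where l: "l \<in> ?S" "s l = i" by auto
    then have "m l = a i" using nz[OF l(1)] by (simp add: ibinom_0 split: if_splits)
    have si: "s i \<in> ?S" using permutes_in_image[OF s] \<open>i \<le> k\<close> by simp
    have "m i \<le> a (s i) + int (s i - i)"
      using ibinom_nonzero[OF nz[of i]] \<open>i \<le> k\<close> by simp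
    also have "\<dots> \<le> a i" using strict_antimono_gap[of i k a i "s i"] a si by auto
    finally have "m i \<le> m l" using \<open>m l = a i\<close> by simp
    moreover have "m l + int (l - i) \<le> m i" using strict_antimono_gap[of i k m i l] m l by auto
    ultimately have "l = i" using l by simp
    then show ?thesis using l \<open>m l = a i\<close> by simp
  qed
  show ?thesis
  proof (cases "m i = a i")
    case False
    then have "sign s * ?t s = 0" if "s permutes ?S" for s using fixed[OF that] by auto
    then have "minor a k i m = 0" unfolding minor_def by (intro sum.neutral ballI) simp
    then show ?thesis using False by simp
  next
    case True
    have S: "?S = insert i ?T" using \<open>i \<le> k\<close> by auto
    have "minor a k i m = (\<Sum>s | s permutes ?T. sign s * ?t s)"
      unfolding minor_def
    proof (rule sum.mono_neutral_right)
      show "finite {s. s permutes ?S}" by (simp add: finite_permutations)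
      show "{s. s permutes ?T} \<subseteq> {s. s permutes ?S}"
        using permutes_subset[of _ ?T ?S] by (auto simp: S)
      show "\<forall>s\<in>{s. s permutes ?S} - {s. s permutes ?T}. sign s * ?t s = 0"
      proof
        fix s assume s: "s \<in> {s. s permutes ?S} - {s. s permutes ?T}"
        have "s i \<noteq> i"
          using s permutes_superset[of s ?S ?T] by (auto simp: S)
        then show "sign s * ?t s = 0" using fixed[of s] s by auto
      qed
    qed
    also have "\<dots> = (\<Sum>s | s permutes ?T. \<Sum>X\<in>Pow ?T.
        sign s * (\<Prod>l\<in>?T. ibinom (s l - Suc i) (m l - of_bool (l \<in> X) - a (s l))))"
    proof (rule sum.cong)
      fix s assume "s \<in> {s. s permutes ?T}"
      then have s: "s permutes ?T" by simp
      have si: "s i = i" using permutes_not_in[OF s] by simp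
      let ?f = "\<lambda>l. ibinom (s l - Suc i) (m l - 1 - a (s l))"
      let ?g = "\<lambda>l. ibinom (s l - Suc i) (m l - a (s l))"
      have "?t s = (\<Prod>l\<in>?T. ibinom (s l - i) (m l - a (s l)))"
        by (simp add: S si True ibinom_0)
      \<comment> \<open>Pascal's rule splits each factor; in the expansion \<open>X\<close> collects
        the columns whose exponent is lowered. The range of \<open>X\<close> is the same for every
        \<open>s\<close>, so the sums can be exchanged.\<close>
      also have "\<dots> = (\<Prod>l\<in>?T. ?f l + ?g l)"
      proof (rule prod.cong)
        fix l assume "l \<in> ?T"
        then have "s l \<in> ?T" using permutes_in_image[OF s] by simp
        then have "s l - i = Suc (s l - Suc i)" by auto
        then show "ibinom (s l - i) (m l - a (s l)) = ?f l + ?g l"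
          by (simp add: ibinom_Suc algebra_simps)
      qed simp
      also have "\<dots> = (\<Sum>X\<in>Pow ?T. (\<Prod>l\<in>X. ?f l) * (\<Prod>l\<in>?T - X. ?g l))"
        by (rule prod_add) simp
      also have "\<dots> = (\<Sum>X\<in>Pow ?T. \<Prod>l\<in>?T. ibinom (s l - Suc i) (m l - of_bool (l \<in> X) - a (s l)))"
      proof (rule sum.cong)
        fix X assume "X \<in> Pow ?T"
        then have "(\<Prod>l\<in>?T. ibinom (s l - Suc i) (m l - of_bool (l \<in> X) - a (s l)))
          = (\<Prod>l\<in>?T - X. ibinom (s l - Suc i) (m l - of_bool (l \<in> X) - a (s l)))
            * (\<Prod>l\<in>X. ibinom (s l - Suc i) (m l - of_bool (l \<in> X) - a (s l)))"
          by (intro prod.subset_diff) auto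
        also have "\<dots> = (\<Prod>l\<in>X. ?f l) * (\<Prod>l\<in>?T - X. ?g l)" by simp
        finally show "(\<Prod>l\<in>X. ?f l) * (\<Prod>l\<in>?T - X. ?g l)
          = (\<Prod>l\<in>?T. ibinom (s l - Suc i) (m l - of_bool (l \<in> X) - a (s l)))" by simp
      qed simp
      finally show "sign s * ?t s = (\<Sum>X\<in>Pow ?T.
        sign s * (\<Prod>l\<in>?T. ibinom (s l - Suc i) (m l - of_bool (l \<in> X) - a (s l))))"
        by (simp add: sum_distrib_left)
    qed simp
    also have "\<dots> = (\<Sum>X\<in>Pow ?T. minor a k (Suc i) (\<lambda>l. m l - of_bool (l \<in> X)))"
      unfolding minor_def by (rule sum.swap)
    finally show ?thesis using True by simp
  qed
qed

lemma minor_empty: "minor a k (Suc k) m = 1"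
  by (simp add: minor_def)

text \<open>Weak decrease is what the recursion preserves. Equal neighbours give 0, and otherwise
  \<open>minor_rec\<close> gives 0 or a sum of smaller minors of the same kind.\<close>

lemma minor_nonneg:
  assumes a: "\<And>j. i \<le> j \<Longrightarrow> j < k \<Longrightarrow> a (Suc j) < a j"
    and m: "\<And>l. i \<le> l \<Longrightarrow> l < k \<Longrightarrow> m (Suc l) \<le> m l" and "i \<le> Suc k"
  shows "0 \<le> minor a k i m"
  using assms(3,1,2)
proof (induction arbitrary: m rule: inc_induct)
  case base
  then show ?case by (simp add: minor_empty)
next
  case (step i)
  show ?case
  proof (cases "\<exists>l. i \<le> l \<and> l < k \<and> m (Suc l) = m l")
    case True
    then obtain l where "i \<le> l" "l < k" "m (Suc l) = m l" by blast
    then show ?thesis using minor_repeated[of l i k "Suc l" m] by simp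
  next
    case False
    then have strict: "m (Suc l) < m l" if "i \<le> l" "l < k" for l
    proof -
      have "m (Suc l) \<noteq> m l" using False that by blast
      then show ?thesis using step.prems(2)[OF that] by simp
    qed
    have "0 \<le> minor a k (Suc i) (\<lambda>l. m l - of_bool (l \<in> X))" for X
      by (rule step.IH) (use step.prems(1) antimono_diff[of i k m] strict in auto)
    then show ?thesis
      using minor_rec[of i k a m] step strict by (auto intro: sum_nonneg)
  qed
qed

text \<open>For \<open>t = i\<close> the recursion forces \<open>m i = a i\<close> and strict
  decrease does the rest. For larger \<open>t\<close>, each row removed before \<open>t\<close>
  lowers an exponent by at most 1, which \<open>- int i\<close> accounts for.\<close>

lemma minor_nonzero_bound:
  assumes a: "\<And>j. i \<le> j \<Longrightarrow> j < k \<Longrightarrow> a (Suc j) < a j"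
    and m: "\<And>l. i \<le> l \<Longrightarrow> l < k \<Longrightarrow> m (Suc l) < m l" and "i \<le> Suc k"
    and "minor a k i m \<noteq> 0" and "i \<le> t" "t \<le> l" "l \<le> k"
  shows "m l \<le> a t + 2 * int t - int i - int l"
  using assms(3,1,2,4-)
proof (induction arbitrary: m rule: inc_induct)
  case base
  then show ?case by simp
next
  case (step i)
  note prems = step.prems
  have nz: "m i = a i" "(\<Sum>X\<in>Pow {Suc i..k}. minor a k (Suc i) (\<lambda>l. m l - of_bool (l \<in> X))) \<noteq> 0"
    using minor_rec[of i k a m] step by (auto split: if_splits)
  show ?case
  proof (cases "t = i")
    case True
    then show ?thesis using strict_antimono_gap[of i k m i l] nz(1) prems by auto
  next
    case False
    obtain X where X: "minor a k (Suc i) (\<lambda>l. m l - of_bool (l \<in> X)) \<noteq> 0"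
      using nz(2) by (meson sum.not_neutral_contains_not_neutral)
    \<comment> \<open>A nonzero summand has no equal columns, so its exponents still decrease
      strictly.\<close>
    have "m (Suc l) - of_bool (Suc l \<in> X) < m l - of_bool (l \<in> X)" if "Suc i \<le> l" "l < k" for l
    proof -
      have "m (Suc l) - of_bool (Suc l \<in> X) \<noteq> m l - of_bool (l \<in> X)"
      proof
        assume "m (Suc l) - of_bool (Suc l \<in> X) = m l - of_bool (l \<in> X)"
        then show False using minor_repeated[of l "Suc i" k "Suc l" "\<lambda>l. m l - of_bool (l \<in> X)" a] X that
          by simp
      qed
      then show ?thesis using antimono_diff[of i k m l X] prems(2) that by simp
    qed
    then have "m l - of_bool (l \<in> X) \<le> a t + 2 * int t - int (Suc i) - int l"
      using step.IH[of "\<lambda>l. m l - of_bool (l \<in> X)"] prems False X by auto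
    then show ?thesis by (auto simp: of_bool_def split: if_splits)
  qed
qed

text \<open>Lowering the entries that can be lowered, the extremal exponents for \<open>i\<close> become those for
  \<open>Suc i\<close>, so they contribute to the sum in \<open>minor_rec\<close>.\<close>
lemma minor_extremal_pos:
  assumes a: "\<And>j. i \<le> j \<Longrightarrow> j < k \<Longrightarrow> a (Suc j) < a j" and "i \<le> Suc k"
  shows "0 < minor a k i (\<lambda>l. Min ((\<lambda>t. a t + 2 * int t) ` {i..l}) - int i - int l)"
  using assms(2,1)
proof (induction rule: inc_induct)
  case base
  then show ?case by (simp add: minor_empty)
next
  case (step i)
  define b where "b = (\<lambda>t. a t + 2 * int t)"
  define M where "M = (\<lambda>i l. Min (b ` {i..l}) - int i - int l)"
  have Min_Suc: "Min (b ` {i..Suc l}) \<le> Min (b ` {i..l})" if "i \<le> l" for l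
    using that by (intro Min_antimono) auto
  have strict: "M i (Suc l) < M i l" if "i \<le> l" for l
    unfolding M_def using Min_Suc[OF that] by linarith
  have Mi: "M i i = a i" by (simp add: M_def b_def)
  \<comment> \<open>The columns to be lowered. As \<open>b (Suc i) \<le> b i + 1\<close>, including
    \<open>b i\<close> lowers the minimum by at most 1, so the extremal exponents for
    \<open>i\<close> exceed those for \<open>Suc i\<close> by 0 or 1.\<close>
  define X where "X = {l \<in> {Suc i..k}. M i l \<noteq> M (Suc i) l}"
  have X: "M i l - of_bool (l \<in> X) = M (Suc i) l" if "Suc i \<le> l" "l \<le> k" for l
  proof -
    have "{i..l} = insert i {Suc i..l}" using that by auto
    then have min: "Min (b ` {i..l}) = min (b i) (Min (b ` {Suc i..l}))"
      using that by (simp add: Min_insert)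
    have "Min (b ` {Suc i..l}) \<le> b (Suc i)" using that by (intro Min_le) auto
    also have "b (Suc i) \<le> b i + 1" using step.prems[of i] that by (simp add: b_def)
    finally have "M i l = M (Suc i) l \<or> M i l = M (Suc i) l + 1"
      using min by (auto simp: M_def min_def)
    then show ?thesis using that by (auto simp: X_def)
  qed
  have "0 < minor a k (Suc i) (\<lambda>l. M (Suc i) l)"
    using step by (simp add: M_def b_def)
  also have "\<dots> = minor a k (Suc i) (\<lambda>l. M i l - of_bool (l \<in> X))"
    by (rule minor_cong) (simp add: X)
  finally have pos: "0 < minor a k (Suc i) (\<lambda>l. M i l - of_bool (l \<in> X))" .
  \<comment> \<open>There is no cancellation: all summands are nonnegative and the one for
    \<open>X\<close> is positive.\<close>
  have "0 < (\<Sum>X\<in>Pow {Suc i..k}. minor a k (Suc i) (\<lambda>l. M i l - of_bool (l \<in> X)))"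
  proof (rule sum_pos2[where i = X])
    show "0 < minor a k (Suc i) (\<lambda>l. M i l - of_bool (l \<in> X))" by (rule pos)
    show "0 \<le> minor a k (Suc i) (\<lambda>l. M i l - of_bool (l \<in> Y))" for Y
      by (rule minor_nonneg) (use step antimono_diff[of i k "M i"] strict in auto)
  qed (auto simp: X_def)
  then have "0 < minor a k i (M i)"
    using minor_rec[of i k a "M i"] step Mi strict by auto
  then show ?case by (simp add: M_def b_def)
qed

section \<open>Degrees of the antisymmetrized products and of the Grothendieck polynomial\<close>

lemma exists_decreasing_rearrangement:
  fixes m :: "nat \<Rightarrow> nat"
  shows "\<exists>t. t permutes {1..k} \<and> (\<forall>l. 1 \<le> l \<and> l < k \<longrightarrow> m (t (Suc l)) \<le> m (t l))"
proof (induction m rule: ascent_induct[of k])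
  case (ascents m)
  show ?case
  proof (cases "\<exists>i. 1 \<le> i \<and> i < k \<and> m i < m (Suc i)")
    case True
    then obtain i where i: "1 \<le> i" "i < k" "m i < m (Suc i)" by blast
    then obtain t where "t permutes {1..k}" "\<forall>l. 1 \<le> l \<and> l < k \<longrightarrow> m ((tr i \<circ> t) (Suc l)) \<le> m ((tr i \<circ> t) l)"
      using ascents[of i] by auto
    then show ?thesis using permutes_compose[OF _ tr_permutes[OF i(1,2)]] by blast
  next
    case False
    then show ?thesis by (intro exI[of _ id] conjI permutes_id) (auto simp: not_less)
  qed
qed

text \<open>The monomial with the extremal exponents occurs. Any monomial that occurs is, once
  sorted, bounded by it in every variable; sorting preserves the degree and changes the minor only
  by a sign.\<close>

lemma total_degree_antisym_theta_mult:
  fixes a :: "nat \<Rightarrow> nat"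
  assumes a: "\<And>j. 1 \<le> j \<Longrightarrow> j < k \<Longrightarrow> a (Suc j) < a j"
  shows "antisym k (theta k * (\<Prod>j\<in>{1..k}. var j ^ a j)) \<noteq> 0" (is "?R \<noteq> 0")
    and "int (total_degree (antisym k (theta k * (\<Prod>j\<in>{1..k}. var j ^ a j))))
      = (\<Sum>l\<in>{1..k}. Min ((\<lambda>t. int (a t) + 2 * int t) ` {1..l}) - 1 - int l)" (is "_ = ?d")
proof -
  define M where "M = (\<lambda>l. Min ((\<lambda>t. int (a t) + 2 * int t) ` {1..l}) - 1 - int l)"
  have a': "\<And>j. 1 \<le> j \<Longrightarrow> j < k \<Longrightarrow> int (a (Suc j)) < int (a j)" using a by simp
  \<comment> \<open>Strict decrease in the natural numbers gives \<open>a t \<ge> k - t\<close>, so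
    \<open>nat (M l)\<close> loses nothing.\<close>
  have M_nonneg: "0 \<le> M l" if "1 \<le> l" "l \<le> k" for l
  proof -
    have "1 + int l \<le> int (a t) + 2 * int t" if t: "t \<in> {1..l}" for t
      using strict_antimono_gap[of 1 k "\<lambda>j. int (a j)" t k] a' t \<open>l \<le> k\<close> by auto
    then have "1 + int l \<le> Min ((\<lambda>t. int (a t) + 2 * int t) ` {1..l})"
      using that by (subst Min_ge_iff) auto
    then show ?thesis by (simp add: M_def)
  qed
  define m0 where "m0 = (\<Sum>l\<in>{1..k}. Poly_Mapping.single l (nat (M l)))"
  have m0: "Poly_Mapping.lookup m0 l = (if l \<in> {1..k} then nat (M l) else 0)" for l
    by (simp add: m0_def lookup_sum lookup_single when_def sum.delta' del: atLeastAtMost_iff)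
  have keys_m0: "Poly_Mapping.keys m0 \<subseteq> {1..k}"
    by (auto simp: in_keys_iff m0 split: if_splits)
  have "minor (\<lambda>j. int (a j)) k 1 (\<lambda>l. int (Poly_Mapping.lookup m0 l)) = minor (\<lambda>j. int (a j)) k 1 M"
    by (rule minor_cong) (simp add: m0 M_nonneg)
  moreover have "0 < minor (\<lambda>j. int (a j)) k 1 M"
    using minor_extremal_pos[of 1 k "\<lambda>j. int (a j)"] a' by (simp add: M_def)
  ultimately have in_keys: "m0 \<in> Poly_Mapping.keys ?R"
    using keys_m0 unfolding in_keys_iff lookup_antisym_theta_mult by simp
  then show "?R \<noteq> 0" by auto
  have deg_m0: "int (mono_degree m0) = ?d"
    by (simp add: mono_degree_eq_sum[OF _ keys_m0] m0 M_nonneg) (simp add: M_def)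
  have "total_degree ?R = mono_degree m0"
  proof (rule total_degree_eqI[OF in_keys refl])
    fix m assume "m \<in> Poly_Mapping.keys ?R"
    then have keys: "Poly_Mapping.keys m \<subseteq> {1..k}"
      and nz: "minor (\<lambda>j. int (a j)) k 1 (\<lambda>l. int (Poly_Mapping.lookup m l)) \<noteq> 0"
      unfolding in_keys_iff lookup_antisym_theta_mult by (auto split: if_splits)
    obtain t where t: "t permutes {1..k}"
      and dec: "\<And>l. 1 \<le> l \<Longrightarrow> l < k \<Longrightarrow> Poly_Mapping.lookup m (t (Suc l)) \<le> Poly_Mapping.lookup m (t l)"
      using exists_decreasing_rearrangement[of k "Poly_Mapping.lookup m"] by auto
    define v where "v = (\<lambda>l. int (Poly_Mapping.lookup m l)) \<circ> t"
    have nz': "minor (\<lambda>j. int (a j)) k 1 v \<noteq> 0"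
      using nz minor_permute[OF t] by (simp add: v_def)
    have "v (Suc l) < v l" if "1 \<le> l" "l < k" for l
    proof -
      have "v (Suc l) \<noteq> v l"
        using minor_repeated[of l 1 k "Suc l" v] nz' that by auto
      then show ?thesis using dec[OF that] by (simp add: v_def)
    qed
    then have "v l \<le> int (a s) + 2 * int s - 1 - int l" if "1 \<le> s" "s \<le> l" "l \<le> k" for l s
      using minor_nonzero_bound[of 1 k "\<lambda>j. int (a j)" v s l] a' nz' that by simp
    then have bound: "v l \<le> M l" if "l \<in> {1..k}" for l
      unfolding M_def le_diff_eq using that by (subst Min_ge_iff) (auto simp: algebra_simps)
    have "int (mono_degree m) = (\<Sum>l\<in>{1..k}. int (Poly_Mapping.lookup m l))"
      using mono_degree_eq_sum[OF _ keys] by simp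
    also have "\<dots> = (\<Sum>l\<in>{1..k}. v l)"
      unfolding v_def by (rule sum.permute[OF t])
    also have "\<dots> \<le> (\<Sum>l\<in>{1..k}. M l)" by (rule sum_mono) (rule bound)
    also have "\<dots> = int (mono_degree m0)" using deg_m0 by (simp add: M_def)
    finally show "mono_degree m \<le> mono_degree m0" by simp
  qed
  then show "int (total_degree ?R) = ?d" using deg_m0 by simp
qed

lemma groth_id: "groth k id = 1"
proof -
  have "lehmer k id i = 0" for i by (simp add: lehmer_def)
  then show ?thesis using groth_dominant[OF permutes_id, of k] by simp
qed

text \<open>The degree formula wants strictly decreasing exponents. The identity of
  \<open>S_k\<close>, whose Grothendieck polynomial is 1, supplies them:
  \<open>antisym k (theta k)\<close> is unchanged when \<open>theta k\<close> is multiplied by the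
  staircase monomial.\<close>

lemma total_degree_theta:
  "antisym k (theta k) \<noteq> 0"
  "int (total_degree (antisym k (theta k))) = (\<Sum>l\<in>{1..k}. int k - int l)"
proof -
  have eq: "antisym k (theta k) = antisym k (theta k * (\<Prod>j\<in>{1..k}. var j ^ (k - j)))"
    using groth_grassmannian_mult[OF permutes_id order_refl, of k] by (simp add: groth_id)
  show "antisym k (theta k) \<noteq> 0"
    unfolding eq by (rule total_degree_antisym_theta_mult) auto
  have Min: "Min ((\<lambda>t. int (k - t) + 2 * int t) ` {1..l}) = int k + 1" if "l \<in> {1..k}" for l
    by (rule Min_eqI) (use that in \<open>auto intro!: image_eqI[of _ _ 1]\<close>)
  have "int (total_degree (antisym k (theta k * (\<Prod>j\<in>{1..k}. var j ^ (k - j)))))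
      = (\<Sum>l\<in>{1..k}. Min ((\<lambda>t. int (k - t) + 2 * int t) ` {1..l}) - 1 - int l)"
    by (rule total_degree_antisym_theta_mult) auto
  also have "\<dots> = (\<Sum>l\<in>{1..k}. int k - int l)"
  proof (rule sum.cong)
    fix l assume l: "l \<in> {1..k}"
    show "Min ((\<lambda>t. int (k - t) + 2 * int t) ` {1..l}) - 1 - int l = int k - int l"
      unfolding Min[OF l] by simp
  qed simp
  finally show "int (total_degree (antisym k (theta k))) = (\<Sum>l\<in>{1..k}. int k - int l)"
    using eq by simp
qed

text \<open>The degree is a difference of two known ones. With \<open>a t = lam t + k - t\<close>,
  the minimum of \<open>a t + 2 t\<close> is \<open>k + 1\<close> plus that of
  \<open>lam t + t - 1\<close>; the remaining terms \<open>k - l\<close> add up to the degree of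
  \<open>antisym k (theta k)\<close>.\<close>

lemma total_degree_groth_grassmannian:
  assumes w: "w permutes {1..n}" "k \<le> n"
    and mono: "\<And>i j. 1 \<le> i \<Longrightarrow> i < j \<Longrightarrow> j \<le> k \<Longrightarrow> w i < w j"
    and mono': "\<And>i j. k < i \<Longrightarrow> i < j \<Longrightarrow> j \<le> n \<Longrightarrow> w i < w j"
    and lam: "\<And>j. 1 \<le> j \<Longrightarrow> j \<le> k \<Longrightarrow> w (k + 1 - j) = lam j + (k + 1 - j)"
  shows "total_degree (groth n w) = (\<Sum>l\<in>{1..k}. Min ((\<lambda>t. lam t + t - 1) ` {1..l}))"
proof -
  define a where "a j = w (k + 1 - j) - 1" for j
  let ?R = "antisym k (theta k * (\<Prod>j\<in>{1..k}. var j ^ a j))"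
  have a: "a (Suc j) < a j" if "1 \<le> j" "j < k" for j
  proof -
    have "w (k - j) < w (k + 1 - j)" using mono[of "k - j" "k + 1 - j"] that by simp
    moreover have "k - j \<in> {1..n}" using that w(2) by auto
    then have "1 \<le> w (k - j)" using permutes_in_image[OF w(1), of "k - j"] by simp
    ultimately show ?thesis by (simp add: a_def)
  qed
  have eq: "antisym k (theta k) * groth n w = ?R"
    unfolding a_def by (rule groth_grassmannian_mult) (use assms in auto)
  have nz: "groth n w \<noteq> 0"
  proof
    assume "groth n w = 0"
    then show False using eq total_degree_antisym_theta_mult(1)[of k a] a by simp
  qed
  then have "int (total_degree (antisym k (theta k))) + int (total_degree (groth n w)) = int (total_degree ?R)"
    using total_degree_mult[OF total_degree_theta(1) nz, of k] unfolding eq by simp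
  also have "\<dots> = (\<Sum>l\<in>{1..k}. Min ((\<lambda>t. int (a t) + 2 * int t) ` {1..l}) - 1 - int l)"
    by (rule total_degree_antisym_theta_mult) (rule a)
  also have "\<dots> = (\<Sum>l\<in>{1..k}. (int k - int l) + int (Min ((\<lambda>t. lam t + t - 1) ` {1..l})))"
  proof (rule sum.cong)
    fix l assume l: "l \<in> {1..k}"
    have "(\<lambda>t. int (a t) + 2 * int t) ` {1..l} = (\<lambda>x. int x + (int k + 1)) ` (\<lambda>t. lam t + t - 1) ` {1..l}"
      unfolding image_image by (rule image_cong) (use l lam in \<open>auto simp: a_def\<close>)
    also have "Min \<dots> = int (Min ((\<lambda>t. lam t + t - 1) ` {1..l})) + (int k + 1)"
      by (rule mono_Min_commute[symmetric]) (use l in \<open>auto simp: mono_def\<close>)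
    finally show "Min ((\<lambda>t. int (a t) + 2 * int t) ` {1..l}) - 1 - int l
      = (int k - int l) + int (Min ((\<lambda>t. lam t + t - 1) ` {1..l}))" by simp
  qed simp
  finally have "int (total_degree (groth n w)) = int (\<Sum>l\<in>{1..k}. Min ((\<lambda>t. lam t + t - 1) ` {1..l}))"
    unfolding total_degree_theta(2) sum.distrib by simp
  then show ?thesis by (simp only: of_nat_eq_iff)
qed

section \<open>Partitions\<close>

lemma entry_map_upt: "entry (map f [1..<i]) j = (if 1 \<le> j \<and> j < i then f j else 0)"
  by (auto simp: entry_def simp del: upt_Suc)

text \<open>With \<open>v = entry lam l\<close>, a staircase of size \<open>m < i\<close> fits iff
  \<open>v + m \<le> entry lam j + j - 1\<close> for all \<open>j \<le> m\<close>. For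
  \<open>m < j \<le> l\<close> this inequality holds anyway, as the entries are at least
  \<open>v\<close>; so the largest \<open>m\<close> is the minimum less \<open>v\<close>.\<close>

lemma entry_plus_sylv:
  assumes dec: "\<And>i j. 1 \<le> i \<Longrightarrow> i \<le> j \<Longrightarrow> j \<le> length lam \<Longrightarrow> entry lam j \<le> entry lam i"
    and i: "1 \<le> i" "i \<le> l" "l \<le> length lam" "entry lam i = entry lam l"
  shows "entry lam l + sylv (map (\<lambda>j. entry lam j - entry lam i) [1..<i])
    = Min ((\<lambda>t. entry lam t + t - 1) ` {1..l})"
proof -
  define v where "v = entry lam l"
  define mu where "mu = Min ((\<lambda>t. entry lam t + t - 1) ` {1..l})"
  let ?nu = "map (\<lambda>j. entry lam j - entry lam i) [1..<i]"
  let ?M = "{m. \<forall>j. 1 \<le> j \<and> j \<le> m \<longrightarrow> m + 1 - j \<le> entry ?nu j}"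
  have nu: "entry ?nu j = (if 1 \<le> j \<and> j < i then entry lam j - v else 0)" for j
    unfolding entry_map_upt v_def i(4) ..
  have mu_le: "mu \<le> entry lam t + t - 1" if "1 \<le> t" "t \<le> l" for t
    unfolding mu_def using that by (intro Min_le) auto
  have v_le: "v \<le> entry lam t" if "1 \<le> t" "t \<le> l" for t
    unfolding v_def using dec that i by blast
  \<comment> \<open>Past its \<open>i - 1\<close> parts \<open>?nu\<close> has entries 0, so row
    \<open>m\<close> of the staircase would not fit. This bounds the set whose \<open>Max\<close> is
    taken.\<close>
  have lt: "m < i" if "m \<in> ?M" for m
  proof (rule ccontr)
    assume "\<not> m < i"
    moreover have "1 \<le> m \<longrightarrow> m + 1 - m \<le> entry ?nu m" using that by blast
    ultimately show False using i nu by auto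
  qed
  have "sylv ?nu = mu - v"
    unfolding sylv_def
  proof (rule Max_eqI)
    show "finite ?M" by (rule finite_subset[of _ "{..<i}"]) (use lt in auto)
  next
    fix m assume m: "m \<in> ?M"
    have "m + v \<le> entry lam t + t - 1" if t: "t \<in> {1..l}" for t
    proof (cases "t \<le> m")
      case True
      then have "m + 1 - t \<le> entry lam t - v" using m lt[OF m] t nu by auto
      then show ?thesis using v_le[of t] True t by auto
    next
      case False
      then show ?thesis using v_le[of t] t by auto
    qed
    then have "m + v \<le> mu" unfolding mu_def using i by (subst Min_ge_iff) auto
    then show "m \<le> mu - v" by simp
  next
    \<comment> \<open>The term \<open>t = i\<close> of the minimum keeps all rows
      \<open>j \<le> mu - v\<close> within the actual parts of \<open>?nu\<close>.\<close>
    have mu_i: "mu \<le> v + i - 1" using mu_le[of i] i by (simp add: v_def)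
    have "mu - v + 1 - j \<le> entry ?nu j" if "1 \<le> j" "j \<le> mu - v" for j
    proof -
      have "j < i" using that mu_i by linarith
      then show ?thesis using that mu_le[of j] v_le[of j] i nu by auto
    qed
    then show "mu - v \<in> ?M" by blast
  qed
  moreover have "v \<le> entry lam t + t - 1" if "t \<in> {1..l}" for t
    using v_le[of t] that by auto
  then have "v \<le> mu" unfolding mu_def using i by (subst Min_ge_iff) auto
  ultimately show ?thesis by (simp add: v_def mu_def)
qed

text \<open>Over each block, \<open>entry_plus_sylv\<close> turns cardinality times
  \<open>sylv\<close> into the sum of \<open>mu l - entry lam l\<close>. The blocks partition the
  indices, and \<open>part_size\<close> restores the subtracted entries.\<close>

lemma part_size_plus_sylv_sum:
  assumes dec: "\<And>i j. 1 \<le> i \<Longrightarrow> i \<le> j \<Longrightarrow> j \<le> length lam \<Longrightarrow> entry lam j \<le> entry lam i"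
  shows "part_size lam + (\<Sum>h\<in>{1..length (set_part lam) - 1}. card (set_part lam ! h) * sylv (lam_h lam h))
    = (\<Sum>l\<in>{1..length lam}. Min ((\<lambda>t. entry lam t + t - 1) ` {1..l}))"
proof -
  define vs where "vs = rev (sorted_list_of_set (set lam))"
  define r where "r = length vs"
  define P where "P = (\<lambda>h. {i. 1 \<le> i \<and> i \<le> length lam \<and> entry lam i = vs ! h})"
  define s where "s = (\<lambda>h. sylv (lam_h lam h))"
  define mu where "mu = (\<lambda>l. Min ((\<lambda>t. entry lam t + t - 1) ` {1..l}))"
  have vs: "set vs = set lam" "distinct vs" "sorted (rev vs)" by (auto simp: vs_def)
  have len: "length (set_part lam) = r" by (simp add: set_part_def r_def vs_def)
  have part: "set_part lam ! h = P h" if "h < r" for h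
    using that by (simp add: set_part_def r_def vs_def P_def)
  have finP: "finite (P h)" for h
    by (rule finite_subset[of _ "{..length lam}"]) (auto simp: P_def)
  have block: "entry lam l + s h = mu l" if h: "h < r" and l: "l \<in> P h" for h l
  proof -
    define i where "i = Min (P h)"
    have "i \<in> P h" "i \<le> l" using finP l by (auto simp: i_def intro: Min_in)
    moreover have "lam_h lam h = map (\<lambda>j. entry lam j - entry lam i) [1..<i]"
      using h by (simp add: lam_h_def i_def part Let_def)
    ultimately show ?thesis using entry_plus_sylv[OF dec, of i l] l by (auto simp: P_def s_def mu_def)
  qed
  have in_lam: "entry lam l \<in> set lam" if "1 \<le> l" "l \<le> length lam" for l
    using that by (auto simp: entry_def)
  \<comment> \<open>With indexing from 0, the sum from \<open>h = 1\<close> omits the first block.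
    Adding it changes nothing: there \<open>mu l \<le> entry lam 1\<close>, which is at most the
    value of that block.\<close>
  have first: "card (P 0) * s 0 = 0" if "0 < r"
  proof (cases "P 0 = {}")
    case False
    then obtain l where l: "l \<in> P 0" by blast
    then have l1: "1 \<le> l" "l \<le> length lam" "entry lam l = vs ! 0" by (auto simp: P_def)
    have "entry lam 1 \<in> set vs" using in_lam[of 1] l1 vs by simp
    then obtain h where "h < length vs" "entry lam 1 = vs ! h" by (metis in_set_conv_nth)
    then have "entry lam 1 \<le> entry lam l" using sorted_rev_nth_mono[OF vs(3), of 0 h] l1 by simp
    moreover have "mu l \<le> entry lam 1 + 1 - 1" unfolding mu_def using l1 by (intro Min_le image_eqI[of _ _ 1]) auto
    ultimately show ?thesis using block[OF that l] by simp
  qed simp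
  have "(\<Sum>h\<in>{1..r - 1}. card (P h) * s h) = (\<Sum>h<r. card (P h) * s h)"
  proof (rule sum.mono_neutral_left)
    show "\<forall>h\<in>{..<r} - {1..r - 1}. card (P h) * s h = 0"
    proof
      fix h assume h: "h \<in> {..<r} - {1..r - 1}"
      then have "h = 0" "0 < r" by auto
      then show "card (P h) * s h = 0" using first by simp
    qed
    show "{1..r - 1} \<subseteq> {..<r}" by auto
  qed simp
  also have "\<dots> = (\<Sum>h<r. \<Sum>l\<in>P h. s h)" by simp
  also have "\<dots> = (\<Sum>h<r. \<Sum>l\<in>P h. mu l - entry lam l)"
    by (intro sum.cong refl) (metis block add_diff_cancel_left' lessThan_iff)
  also have "\<dots> = (\<Sum>l\<in>(\<Union>h<r. P h). mu l - entry lam l)"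
    using vs(2) by (intro sum.UNION_disjoint[symmetric])
      (auto simp: finP, auto simp: P_def r_def nth_eq_iff_index_eq)
  also have "(\<Union>h<r. P h) = {1..length lam}"
  proof
    show "{1..length lam} \<subseteq> (\<Union>h<r. P h)"
    proof
      fix l assume l: "l \<in> {1..length lam}"
      then have "entry lam l \<in> set vs" using in_lam vs by simp
      then obtain h where "h < length vs" "entry lam l = vs ! h" by (metis in_set_conv_nth)
      then show "l \<in> (\<Union>h<r. P h)" using l by (auto simp: P_def r_def)
    qed
  qed (auto simp: P_def)
  finally have blocks: "(\<Sum>h\<in>{1..r - 1}. card (P h) * s h) = (\<Sum>l\<in>{1..length lam}. mu l - entry lam l)" .
  have le: "entry lam l \<le> mu l" if "l \<in> {1..length lam}" for l
  proof -
    have "entry lam l \<in> set vs" using in_lam that vs by simp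
    then obtain h where "h < length vs" "entry lam l = vs ! h" by (metis in_set_conv_nth)
    then have "h < r" "l \<in> P h" using that by (auto simp: P_def r_def)
    then show ?thesis using block by (metis le_add1)
  qed
  have "part_size lam = (\<Sum>l\<in>{1..length lam}. entry lam l)"
    unfolding part_size_def sum_list_sum_nth
    by (rule sum.reindex_bij_witness[of _ "\<lambda>l. l - 1" Suc]) (auto simp: entry_def)
  then have "part_size lam + (\<Sum>h\<in>{1..r - 1}. card (P h) * s h) = (\<Sum>l\<in>{1..length lam}. mu l)"
    unfolding blocks by (simp only: sum.distrib[symmetric]) (rule sum.cong, use le in auto)
  moreover have "(\<Sum>h\<in>{1..length (set_part lam) - 1}. card (set_part lam ! h) * sylv (lam_h lam h))
      = (\<Sum>h\<in>{1..r - 1}. card (P h) * s h)"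
    unfolding len by (rule sum.cong) (auto simp: part s_def)
  ultimately show ?thesis by (simp add: mu_def)
qed

lemma strict_mono_between:
  fixes w :: "nat \<Rightarrow> nat"
  assumes step: "\<And>i. a \<le> i \<Longrightarrow> i < b \<Longrightarrow> w i < w (Suc i)" and "a \<le> i" "i < j" "j \<le> b"
  shows "w i < w j"
  using assms(3,4)
proof (induction j)
  case (Suc j)
  have "w j < w (Suc j)" using step[of j] Suc.prems assms(2) by simp
  then show ?case using Suc by (cases "i = j") auto
qed simp

theorem theorem3p11:
  fixes n k :: nat and w :: "nat \<Rightarrow> nat"
  assumes "w permutes {1..n}"
    and "grassmannian_at n w k"
  shows "total_degree (groth n w) =
     part_size (grass_partition w k)
     + (\<Sum>h\<in>{1..length (set_part (grass_partition w k)) - 1}.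
          card (set_part (grass_partition w k) ! h) * sylv (lam_h (grass_partition w k) h))"
proof -
  let ?lam = "grass_partition w k"
  have k: "1 \<le> k" "k < n" using assms(2) by (auto simp: grassmannian_at_def)
  have asc: "w i < w (Suc i)" if "1 \<le> i" "i < n" "i \<noteq> k" for i
  proof -
    have "\<not> w (Suc i) < w i" using assms(2) that by (auto simp: grassmannian_at_def descent_def)
    moreover have "w i \<noteq> w (Suc i)" using permutes_inj[OF assms(1)] by (metis inj_eq n_not_Suc_n)
    ultimately show ?thesis by simp
  qed
  have low: "w i < w j" if "1 \<le> i" "i < j" "j \<le> k" for i j
    by (rule strict_mono_between[of 1 k]) (use asc k that in auto)
  have high: "w i < w j" if "k < i" "i < j" "j \<le> n" for i j
    by (rule strict_mono_between[of "Suc k" n]) (use asc k that in auto)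
  \<comment> \<open>It makes the truncated subtractions in \<open>grass_partition\<close>
    exact.\<close>
  have ge: "i \<le> w i" if "1 \<le> i" "i \<le> k" for i
    using that
  proof (induction i rule: dec_induct)
    case base
    show ?case using permutes_in_image[OF assms(1), of 1] k by simp
  next
    case (step i)
    then show ?case using low[of i "Suc i"] by simp
  qed
  have len: "length ?lam = k" by (simp add: grass_partition_def)
  have entry: "entry ?lam j = w (k + 1 - j) - (k + 1 - j)" if "1 \<le> j" "j \<le> k" for j
    unfolding grass_partition_def entry_map_upt using that by simp
  \<comment> \<open>Since \<open>w\<close> grows by at least 1 per position, \<open>w i - i\<close>
    is weakly increasing; \<open>grass_partition\<close> lists these values from
    \<open>i = k\<close> downwards.\<close>
  have adj: "entry ?lam (Suc j) \<le> entry ?lam j" if "1 \<le> j" "j < k" for j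
  proof -
    have "w (k - j) < w (Suc (k - j))" by (rule low) (use that in auto)
    then show ?thesis using that by (simp add: entry Suc_diff_le)
  qed
  have dec: "entry ?lam j \<le> entry ?lam i" if "1 \<le> i" "i \<le> j" "j \<le> length ?lam" for i j
    using that(2,3)
  proof (induction j rule: dec_induct)
    case (step j)
    then show ?case using adj[of j] \<open>1 \<le> i\<close> len by simp
  qed simp
  have "total_degree (groth n w) = (\<Sum>l\<in>{1..k}. Min ((\<lambda>t. entry ?lam t + t - 1) ` {1..l}))"
  proof (rule total_degree_groth_grassmannian[OF assms(1)])
    show "w (k + 1 - j) = entry ?lam j + (k + 1 - j)" if "1 \<le> j" "j \<le> k" for j
    proof -
      have "k + 1 - j \<le> w (k + 1 - j)" by (rule ge) (use that in auto)
      then show ?thesis unfolding entry[OF that] by simp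
    qed
  qed (use k low high in auto)
  then show ?thesis using part_size_plus_sylv_sum[OF dec] by (simp only: len)
qed

end
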